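(* Let $A$ be a finite dimensional cocommutative Hopf algebra over a commutative field $\mathbb{K}$, and let $w$ be a normalized $3$-cocycle of the multiplicative Hochschild chain complex of $A$ with coefficients in $\mathbb{K}$. The constructions of quasi-Hopf algebras of R. Dijkgraaf, V. Pasquier, P. Roche and of D. Bulacu, F. Panaite (associated to $w$) are those obtained by deforming the Drinfeld double of $A$ with the image of $w$ under the multiplicative Hochschild–Serre identity.
   Context: Notation. Sweedler notation is used, extended to tensor powers of $A$. $\mathbb{K}$ is an $A$-bimodule via the counit $\varepsilon$, and $\mathrm{ad}_a(b)=\sum \mathrm S(a_{(1)})\,b\,a_{(2)}$. For a cocommutative coalgebra $C$, $\mathrm{Reg}(C,\mathbb{K})$ is the group of convolution-invertible linear maps $C\to\mathbb{K}$. $\mathrm{Reg}_N(A^{\otimes n},\mathbb{K})$ consists of those $f\in\mathrm{Reg}(A^{\otimes n},\mathbb{K})$ with $f(a^1\otimes\cdots\otimes a^n)=\varepsilon(a^1)\cdots\varepsilon(a^n)$ whenever one of the $a^i$ is $1_A$. Inverses $w^{-1}$, $\theta^{-1}$, $\gamma^{-1}$ are convolution inverses. Normalized 3-cocycle: $w\in\mathrm{Reg}_N(A^{\otimes 3},\mathbb{K})$ with $\widetilde\delta_3(w)=\varepsilon$ (the counit of $A^{\otimes 4}$), where $$\widetilde\delta_3(f)(x\otimes y\otimes z\otimes t)=\sum \varepsilon(x_{(1)})f(y_{(1)}\otimes z_{(1)}\otimes t_{(1)})\,f^{-1}(x_{(2)}y_{(2)}\otimes z_{(2)}\otimes t_{(2)})\,f(x_{(3)}\otimes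 y_{(3)}z_{(3)}\otimes t_{(3)})\,f^{-1}(x_{(4)}\otimes y_{(4)}\otimes z_{(4)}t_{(4)})\,f(x_{(5)}\otimes y_{(5)}\otimes z_{(5)})\varepsilon(t_{(5)}).$$ $C_N^{p,q}(A,\mathbb{K})$ is the group of linear maps $A^{\otimes p}\to\mathrm{Hom}_{\mathbb{K}}(A^{\otimes q},\mathbb{K})$ invertible for the convolution $(f*g)(\underline a)(\underline x)=\sum f(\underline a_{(1)})(\underline x_{(1)})\,g(\underline a_{(2)})(\underline x_{(2)})$, and equal to the product of the counits of all arguments whenever one argument is $1_A$. Deforming the Drinfeld double. The Drinfeld double of $A$ is a Hopf algebra with underlying space $A^*\otimes A$, where $A^*$ is the dual Hopf algebra, an $A$-bimodule by $(xf)(a)=f(ax)$, $(fx)(a)=f(xa)$; its product is $(f\otimes x)\cdot(g\otimes y)=\sum f(x_{(1)}g\,\mathrm S(x_{(2)}))\otimes x_{(3)}y$ and its coproduct is $\Delta(f\otimes x)=\sum(f_{(1)}\otimes x_{(1)})\otimes(f_{(2)}\otimes x_{(2)})$. Deforming it with $(w,\gamma,\theta,w_1)$, where $w,w_1\in\mathrm{Reg}_N(A^{\otimes3},\mathbb{K})$, $\gamma\in C_N^{1,2}(A,\mathbb{K})$, $\theta\in C_N^{2,1}(A,\mathbb{K})$, means giving $A^*\otimes A$ the following structure, in which $w_1$ does not appear. Write $\gamma(x)=\sum\gamma(x)_{(1)}\otimes\gamma(x)_{(2)}\in A^*\otimes A^*$ and $w^{\pm1}=\sum w^{\pm1}_{(1)}\otimes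 w^{\pm1}_{(2)}\otimes w^{\pm1}_{(3)}\in(A^* )^{\otimes 3}$. - product: $(f\otimes x)\cdot(g\otimes y)=\sum f\,(x_{(1)}g\,\mathrm S(x_{(2)}))\,\theta(x_{(3)}\otimes y_{(1)})\otimes x_{(4)}y_{(2)}$; - coproduct: $\Delta_\gamma(f\otimes x)=\sum(f_{(1)}\gamma(x_{(1)})_{(1)}\otimes x_{(2)})\otimes(f_{(2)}\gamma(x_{(1)})_{(2)}\otimes x_{(3)})$; - unit and counit: those of the tensor product of the bialgebras $A^*$ and $A$; - antipode: $\mathrm S(f\otimes x)=\sum(\varepsilon\otimes\mathrm S(x_{(1)}))\cdot\big(\theta^{-1}(x_{(2)}\otimes\mathrm S(x_{(3)}))\,\mathrm S(f\gamma^{-1}(x_{(4)})_{(1)})\,\gamma^{-1}(x_{(4)})_{(2)}\otimes1_A\big)$; - associator: $\phi=\sum(w^{-1}_{(1)}\otimes1_A)\otimes(w^{-1}_{(2)}\otimes1_A)\otimes(w^{-1}_{(3)}\otimes1_A)$; - elements: $\alpha=\varepsilon\otimes1_A$ and $\beta=\sum(w_{(1)}\mathrm S(w_{(2)})w_{(3)})\otimes1_A$. The constructions of Dijkgraaf–Pasquier–Roche (for the Hopf algebra of a finite group) and Bulacu–Panaite (for finite dimensional cocommutative Hopf algebras): the quasi-Hopf algebra structure on $A^*\otimes A$ described by the list above for the normalized 3-cocycle $w$ and the particular maps defined for $x,y,z\in A$ by $$\begin{aligned}\theta(x\otimes y)(z)=\sum\;& w(z_{(1)}\otimes x_{(1)}\otimes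 y_{(1)})\,w^{-1}(x_{(2)}\otimes\mathrm{ad}_{x_{(3)}}z_{(2)}\otimes y_{(2)})\,w(x_{(4)}\otimes y_{(3)}\otimes\mathrm{ad}_{x_{(5)}y_{(4)}}z_{(3)}),\\ \gamma(z)(x\otimes y)=\sum\;& w(x_{(1)}\otimes y_{(1)}\otimes z_{(1)})\,w^{-1}(x_{(2)}\otimes z_{(2)}\otimes\mathrm{ad}_{z_{(3)}}y_{(2)})\,w(z_{(4)}\otimes\mathrm{ad}_{z_{(5)}}x_{(3)}\otimes\mathrm{ad}_{z_{(6)}}y_{(3)}).\end{aligned}$$ Multiplicative Hochschild–Serre identity: the map $\widetilde\Lambda\circ\widetilde{\varphi_\sigma}$ from $\bigoplus_n\mathrm{Reg}_N(A^{\otimes n},\mathbb{K})$ to $\bigoplus_n\bigoplus_{p+q=n}C_N^{p,q}(A,\mathbb{K})$ defined as follows. Let $\sigma(a\otimes b)=\sum b_{(1)}\otimes\mathrm{ad}_{b_{(2)}}a$ (Woronowicz braiding) and $\sigma_i=\mathrm{Id}^{\otimes i-1}\otimes\sigma\otimes\mathrm{Id}^{\otimes n-i-1}$ on $A^{\otimes n}$. Let $S_{p,n}$ be the set of permutations $u$ of $\{1,\dots,n\}$ with $u(1)<\dots<u(p)$ and $u(p+1)<\dots<u(n)$, and $T_\sigma(u)=\sigma_{i_1}\cdots\sigma_{i_r}$ for a reduced decomposition $u=\nu_{i_1}\cdots\nu_{i_r}$ into transpositions $\nu_i=(i,i+1)$. For $f\in\mathrm{Reg}_N(A^{\otimes n},\mathbb{K})$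 and $p+q=n$, the component of $\widetilde{\varphi_\sigma}(f)$ in $\mathrm{Reg}(A^{\otimes p}\otimes A^{\otimes q},\mathbb{K})$ is the convolution product over $u\in S_{p,n}$ of the maps $f^{(-1)^{|u|}}\circ T_\sigma(u)$, where $(-1)^{|u|}$ is the sign of $u$; and $\widetilde\Lambda(F)(\underline b)(\underline a)=F(\underline a\otimes\underline b)$ sends this component to $C_N^{q,p}(A,\mathbb{K})$. For $n=3$ the image of an element is listed as $(f_0,f_1,f_2,f_3)$ with $f_l\in C_N^{l,3-l}(A,\mathbb{K})$; deforming with this image means deforming with $(w,\gamma,\theta,w_1)$ replaced by $(f_0,f_1,f_2,f_3)$. *)

theory Defs
  imports
    Complex_Main
    "HOL-Algebra.FiniteProduct"
    "HOL-Combinatorics.Permutations"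
    "HOL-Library.Function_Algebras"
    "HOL-Library.NList"
begin

section \<open>Tensor products\<close>

text \<open>
  Let \<open>P\<close> be the set of tuples of elements of some vector spaces and \<open>M\<close> the set of multilinear
  forms on those tuples.  Over a field the multilinear forms separate the points of the tensor
  product, so the tensor product is realised as the space of functionals on \<open>M\<close> spanned by the
  evaluations at tuples.  In a tensor product of at least one factor every element is a sum of
  pure tensors, scalars being absorbed into a factor.
\<close>

definition pure_tensor :: "('p \<Rightarrow> 'k::field) set \<Rightarrow> 'p \<Rightarrow> ('p \<Rightarrow> 'k) \<Rightarrow> 'k" where
  "pure_tensor M p = (\<lambda>m. if m \<in> M then m p else 0)"

definition tensors :: "('p \<Rightarrow> 'k::field) set \<Rightarrow> 'p set \<Rightarrow> (('p \<Rightarrow> 'k) \<Rightarrow> 'k) set" where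
  "tensors M P = {\<Sum>p\<leftarrow>ps. pure_tensor M p | ps. set ps \<subseteq> P}"

text \<open>
  A presentation of a tensor as a sum of pure ones.  It is always used to evaluate a multilinear
  expression, so that the result does not depend on the choice.
\<close>

definition terms :: "('p \<Rightarrow> 'k::field) set \<Rightarrow> 'p set \<Rightarrow> (('p \<Rightarrow> 'k) \<Rightarrow> 'k) \<Rightarrow> 'p list" where
  "terms M P t = (SOME ps. set ps \<subseteq> P \<and> t = (\<Sum>p\<leftarrow>ps. pure_tensor M p))"

definition lin_ext ::
  "('p \<Rightarrow> 'k::field) set \<Rightarrow> 'p set \<Rightarrow> ('p \<Rightarrow> 'v::monoid_add) \<Rightarrow> (('p \<Rightarrow> 'k) \<Rightarrow> 'k) \<Rightarrow> 'v" where
  "lin_ext M P F t = (\<Sum>p\<leftarrow>terms M P t. F p)"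

text \<open>
  \<open>n\<close>-linear forms on a subspace \<open>V\<close> (scalar multiplication \<open>s\<close>), i.e. linear forms on the
  \<open>n\<close>-th tensor power of \<open>V\<close>.  They are set to \<open>0\<close> outside their domain, so that two of them
  are equal as soon as they agree on \<open>n\<close>-tuples in \<open>V\<close>.
\<close>

definition mult_forms ::
  "('k::field \<Rightarrow> 'v \<Rightarrow> 'v::ab_group_add) \<Rightarrow> 'v set \<Rightarrow> nat \<Rightarrow> ('v list \<Rightarrow> 'k) set" where
  "mult_forms s V n =
    {m. (\<forall>v. v \<notin> nlists n V \<longrightarrow> m v = 0) \<and>
        (\<forall>v\<in>nlists n V. \<forall>i<n. \<forall>x\<in>V. \<forall>y\<in>V. \<forall>c.
           m (v[i := x + y]) = m (v[i := x]) + m (v[i := y]) \<and>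
           m (v[i := s c x]) = c * m (v[i := x]))}"

definition fscale :: "'k::field \<Rightarrow> ('x \<Rightarrow> 'k) \<Rightarrow> 'x \<Rightarrow> 'k" where
  "fscale c f = (\<lambda>x. c * f x)"


section \<open>Finite dimensional cocommutative Hopf algebras\<close>

text \<open>
  Addition, product and unit of the Hopf algebra come from the class \<open>ring_1\<close>; the
  comultiplication takes values in the tensor square.
\<close>

record ('k, 'a) hopf =
  smult :: "'k \<Rightarrow> 'a \<Rightarrow> 'a"
  comult :: "'a \<Rightarrow> ('a list \<Rightarrow> 'k) \<Rightarrow> 'k"
  counit :: "'a \<Rightarrow> 'k"
  antipode :: "'a \<Rightarrow> 'a"

definition forms :: "('k::field, 'a::ring_1) hopf \<Rightarrow> nat \<Rightarrow> ('a list \<Rightarrow> 'k) set" where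
  "forms H n = mult_forms (smult H) UNIV n"

definition tens :: "('k::field, 'a::ring_1) hopf \<Rightarrow> nat \<Rightarrow> 'a list \<Rightarrow> ('a list \<Rightarrow> 'k) \<Rightarrow> 'k" where
  "tens H n = pure_tensor (forms H n)"

text \<open>
  Sweedler notation: \<open>legs H k a\<close> lists the terms of the iterated coproduct of \<open>a\<close> with
  \<open>k \<ge> 1\<close> legs, and \<open>\<Sum>x\<leftarrow>legs H k a. F (x 1) \<dots> (x k)\<close> is the Sweedler sum of
  \<open>F(a\<^sub>1, \<dots>, a\<^sub>k)\<close>.
\<close>

primrec iter_comult :: "('k::field, 'a::ring_1) hopf \<Rightarrow> nat \<Rightarrow> 'a \<Rightarrow> 'a list list" where
  "iter_comult H 0 a = [[a]]"
| "iter_comult H (Suc n) a =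
     concat (map (\<lambda>p. map ((#) (p ! 0)) (iter_comult H n (p ! 1)))
       (terms (forms H 2) (nlists 2 UNIV) (comult H a)))"

definition legs :: "('k::field, 'a::ring_1) hopf \<Rightarrow> nat \<Rightarrow> 'a \<Rightarrow> (nat \<Rightarrow> 'a) list" where
  "legs H k a = map (\<lambda>v i. v ! (i - 1)) (iter_comult H (k - 1) a)"

locale hopf_algebra =
  fixes H :: "('k::field, 'a::ring_1) hopf"
  assumes vector_space: "vector_space (smult H)"
    and smult_mult_left: "smult H c x * y = smult H c (x * y)"
    and smult_mult_right: "x * smult H c y = smult H c (x * y)"
    and comult_tensor: "comult H x \<in> tensors (forms H 2) (nlists 2 UNIV)"
    and comult_linear: "Vector_Spaces.linear (smult H) fscale (comult H)"
    and coassoc: "(\<Sum>p\<leftarrow>legs H 2 x. \<Sum>q\<leftarrow>legs H 2 (p 2). tens H 3 [p 1, q 1, q 2]) =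
                  (\<Sum>p\<leftarrow>legs H 2 x. \<Sum>q\<leftarrow>legs H 2 (p 1). tens H 3 [q 1, q 2, p 2])"
    and counit_linear: "Vector_Spaces.linear (smult H) (*) (counit H)"
    and counit_left: "(\<Sum>p\<leftarrow>legs H 2 x. smult H (counit H (p 1)) (p 2)) = x"
    and counit_right: "(\<Sum>p\<leftarrow>legs H 2 x. smult H (counit H (p 2)) (p 1)) = x"
    and comult_mult: "comult H (x * y) =
                  (\<Sum>p\<leftarrow>legs H 2 x. \<Sum>q\<leftarrow>legs H 2 y. tens H 2 [p 1 * q 1, p 2 * q 2])"
    and comult_one: "comult H 1 = tens H 2 [1, 1]"
    and counit_mult: "counit H (x * y) = counit H x * counit H y"
    and counit_one: "counit H 1 = 1"
    and antipode_linear: "Vector_Spaces.linear (smult H) (smult H) (antipode H)"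
    and antipode_left: "(\<Sum>p\<leftarrow>legs H 2 x. antipode H (p 1) * p 2) = smult H (counit H x) 1"
    and antipode_right: "(\<Sum>p\<leftarrow>legs H 2 x. p 1 * antipode H (p 2)) = smult H (counit H x) 1"

locale fd_cocomm_hopf_algebra = hopf_algebra +
  assumes finite_dim: "\<exists>B. finite_dimensional_vector_space (smult H) B"
    and cocomm: "comult H x = (\<Sum>p\<leftarrow>legs H 2 x. tens H 2 [p 2, p 1])"

definition adj :: "('k::field, 'a::ring_1) hopf \<Rightarrow> 'a \<Rightarrow> 'a \<Rightarrow> 'a" where
  "adj H a b = (\<Sum>x\<leftarrow>legs H 2 a. antipode H (x 1) * b * x 2)"


section \<open>Convolution groups\<close>

text \<open>The coproduct of the tensor coalgebra, as pairs of tuples.\<close>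

primrec splits :: "('k::field, 'a::ring_1) hopf \<Rightarrow> 'a list \<Rightarrow> ('a list \<times> 'a list) list" where
  "splits H [] = [([], [])]"
| "splits H (a # v) =
     concat (map (\<lambda>x. map (\<lambda>(v1, v2). (x 1 # v1, x 2 # v2)) (splits H v)) (legs H 2 a))"

definition counits :: "('k::field, 'a::ring_1) hopf \<Rightarrow> nat \<Rightarrow> 'a list \<Rightarrow> 'k" where
  "counits H n = (\<lambda>v. if length v = n then \<Prod>a\<leftarrow>v. counit H a else 0)"

definition conv ::
  "('k::field, 'a::ring_1) hopf \<Rightarrow> ('a list \<Rightarrow> 'k) \<Rightarrow> ('a list \<Rightarrow> 'k) \<Rightarrow> 'a list \<Rightarrow> 'k" where
  "conv H f g = (\<lambda>v. \<Sum>(v1, v2)\<leftarrow>splits H v. f v1 * g v2)"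

definition Reg :: "('k::field, 'a::ring_1) hopf \<Rightarrow> nat \<Rightarrow> ('a list \<Rightarrow> 'k) monoid" where
  "Reg H n = units_of \<lparr>carrier = forms H n, monoid.mult = conv H, one = counits H n\<rparr>"

definition Reg_N :: "('k::field, 'a::ring_1) hopf \<Rightarrow> nat \<Rightarrow> ('a list \<Rightarrow> 'k) set" where
  "Reg_N H n = {f \<in> carrier (Reg H n).
     \<forall>v. length v = n \<and> 1 \<in> set v \<longrightarrow> f v = (\<Prod>a\<leftarrow>v. counit H a)}"

definition forms2 ::
  "('k::field, 'a::ring_1) hopf \<Rightarrow> nat \<Rightarrow> nat \<Rightarrow> ('a list \<Rightarrow> 'a list \<Rightarrow> 'k) set" where
  "forms2 H p q = {f. (\<forall>a. f a \<in> forms H q) \<and> (\<forall>x. (\<lambda>a. f a x) \<in> forms H p)}"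

definition conv2 ::
  "('k::field, 'a::ring_1) hopf \<Rightarrow> ('a list \<Rightarrow> 'a list \<Rightarrow> 'k) \<Rightarrow> ('a list \<Rightarrow> 'a list \<Rightarrow> 'k)
     \<Rightarrow> 'a list \<Rightarrow> 'a list \<Rightarrow> 'k" where
  "conv2 H f g = (\<lambda>a x. \<Sum>(a1, a2)\<leftarrow>splits H a. \<Sum>(x1, x2)\<leftarrow>splits H x. f a1 x1 * g a2 x2)"

definition C_grp :: "('k::field, 'a::ring_1) hopf \<Rightarrow> nat \<Rightarrow> nat \<Rightarrow> ('a list \<Rightarrow> 'a list \<Rightarrow> 'k) monoid" where
  "C_grp H p q = units_of \<lparr>carrier = forms2 H p q, monoid.mult = conv2 H,
     one = (\<lambda>a x. counits H p a * counits H q x)\<rparr>"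

definition C_N :: "('k::field, 'a::ring_1) hopf \<Rightarrow> nat \<Rightarrow> nat \<Rightarrow> ('a list \<Rightarrow> 'a list \<Rightarrow> 'k) set" where
  "C_N H p q = {f \<in> carrier (C_grp H p q).
     \<forall>a x. length a = p \<and> length x = q \<and> 1 \<in> set a \<union> set x \<longrightarrow>
       f a x = (\<Prod>b\<leftarrow>a @ x. counit H b)}"

definition delta3 :: "('k::field, 'a::ring_1) hopf \<Rightarrow> ('a list \<Rightarrow> 'k) \<Rightarrow> 'a list \<Rightarrow> 'k" where
  "delta3 H f = (\<lambda>v. if length v = 4 then
     (let f' = inv\<^bsub>Reg H 3\<^esub> f in
      \<Sum>x\<leftarrow>legs H 5 (v ! 0). \<Sum>y\<leftarrow>legs H 5 (v ! 1). \<Sum>z\<leftarrow>legs H 5 (v ! 2). \<Sum>t\<leftarrow>legs H 5 (v ! 3).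
        counit H (x 1) * f [y 1, z 1, t 1] * f' [x 2 * y 2, z 2, t 2] * f [x 3, y 3 * z 3, t 3]
          * f' [x 4, y 4, z 4 * t 4] * f [x 5, y 5, z 5] * counit H (t 5))
     else 0)"

definition normalized_3_cocycle :: "('k::field, 'a::ring_1) hopf \<Rightarrow> ('a list \<Rightarrow> 'k) \<Rightarrow> bool" where
  "normalized_3_cocycle H w \<longleftrightarrow> w \<in> Reg_N H 3 \<and> delta3 H w = counits H 4"


section \<open>The multiplicative Hochschild--Serre identity\<close>

text \<open>
  \<open>braid H n i\<close> is the endomorphism \<open>\<sigma>\<^sub>i\<close>, acting on the factors \<open>i\<close> and \<open>i + 1\<close> (counted from
  1) of the \<open>n\<close>-th tensor power.
\<close>

definition braid ::
  "('k::field, 'a::ring_1) hopf \<Rightarrow> nat \<Rightarrow> nat \<Rightarrow> (('a list \<Rightarrow> 'k) \<Rightarrow> 'k) \<Rightarrow> ('a list \<Rightarrow> 'k) \<Rightarrow> 'k" where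
  "braid H n i = lin_ext (forms H n) (nlists n UNIV)
     (\<lambda>v. \<Sum>b\<leftarrow>legs H 2 (v ! i). tens H n (v[i - 1 := b 1, i := adj H (b 2) (v ! (i - 1))]))"

definition shuffles :: "nat \<Rightarrow> nat \<Rightarrow> (nat \<Rightarrow> nat) set" where
  "shuffles p n = {u. u permutes {1..n} \<and> strict_mono_on {1..p} u \<and> strict_mono_on {p+1..n} u}"

definition is_word :: "nat \<Rightarrow> (nat \<Rightarrow> nat) \<Rightarrow> nat list \<Rightarrow> bool" where
  "is_word n u is \<longleftrightarrow> set is \<subseteq> {1..<n} \<and>
     u = foldr (\<circ>) (map (\<lambda>i. Transposition.transpose i (i + 1)) is) id"

text \<open>A reduced decomposition is one of minimal length.\<close>

definition T_braid ::
  "('k::field, 'a::ring_1) hopf \<Rightarrow> nat \<Rightarrow> (nat \<Rightarrow> nat) \<Rightarrow> (('a list \<Rightarrow> 'k) \<Rightarrow> 'k) \<Rightarrow> ('a list \<Rightarrow> 'k) \<Rightarrow> 'k"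
  where
  "T_braid H n u = foldr (\<circ>) (map (braid H n) (arg_min length (is_word n u))) id"

text \<open>
  Precomposition of a linear form on the \<open>n\<close>-th tensor power with an endomorphism: a form takes
  on a tensor \<open>t\<close> the value of the functional \<open>t\<close> at that form.
\<close>

definition precomp ::
  "('k::field, 'a::ring_1) hopf \<Rightarrow> nat \<Rightarrow> ('a list \<Rightarrow> 'k) \<Rightarrow>
     ((('a list \<Rightarrow> 'k) \<Rightarrow> 'k) \<Rightarrow> ('a list \<Rightarrow> 'k) \<Rightarrow> 'k) \<Rightarrow> 'a list \<Rightarrow> 'k" where
  "precomp H n f T = (\<lambda>v. if length v = n then T (tens H n v) f else 0)"

definition phi :: "('k::field, 'a::ring_1) hopf \<Rightarrow> nat \<Rightarrow> nat \<Rightarrow> ('a list \<Rightarrow> 'k) \<Rightarrow> 'a list \<Rightarrow> 'k" where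
  "phi H p n f =
     (\<Otimes>\<^bsub>Reg H n\<^esub>u\<in>shuffles p n. precomp H n (f [^]\<^bsub>Reg H n\<^esub> sign u) (T_braid H n u))"

definition Lambda ::
  "nat \<Rightarrow> nat \<Rightarrow> ('a list \<Rightarrow> 'k::field) \<Rightarrow> 'a list \<Rightarrow> 'a list \<Rightarrow> 'k" where
  "Lambda p q F = (\<lambda>b a. if length b = q \<and> length a = p then F (a @ b) else 0)"

text \<open>The component of bidegree \<open>(l, n - l)\<close> of the image of an element of degree \<open>n\<close>.\<close>

definition hs_component ::
  "('k::field, 'a::ring_1) hopf \<Rightarrow> nat \<Rightarrow> ('a list \<Rightarrow> 'k) \<Rightarrow> nat \<Rightarrow> 'a list \<Rightarrow> 'a list \<Rightarrow> 'k" where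
  "hs_component H n f l = Lambda (n - l) l (phi H (n - l) n f)"


section \<open>Deformations of the Drinfeld double\<close>

subsection \<open>The dual Hopf algebra\<close>

definition dual :: "('k::field, 'a::ring_1) hopf \<Rightarrow> ('a \<Rightarrow> 'k) set" where
  "dual H = {f. Vector_Spaces.linear (smult H) (*) f}"

definition dmult :: "('k::field, 'a::ring_1) hopf \<Rightarrow> ('a \<Rightarrow> 'k) \<Rightarrow> ('a \<Rightarrow> 'k) \<Rightarrow> 'a \<Rightarrow> 'k" where
  "dmult H f g = (\<lambda>a. \<Sum>x\<leftarrow>legs H 2 a. f (x 1) * g (x 2))"

definition dantipode :: "('k::field, 'a::ring_1) hopf \<Rightarrow> ('a \<Rightarrow> 'k) \<Rightarrow> 'a \<Rightarrow> 'k" where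
  "dantipode H f = f \<circ> antipode H"

definition lact :: "'a::ring_1 \<Rightarrow> ('a \<Rightarrow> 'k) \<Rightarrow> 'a \<Rightarrow> 'k" where
  "lact x f = (\<lambda>a. f (a * x))"

definition ract :: "('a::ring_1 \<Rightarrow> 'k) \<Rightarrow> 'a \<Rightarrow> 'a \<Rightarrow> 'k" where
  "ract f x = (\<lambda>a. f (x * a))"

text \<open>
  The terms of an \<open>n\<close>-linear form, viewed as an element of the \<open>n\<close>-th tensor power of the dual
  (recall that the Hopf algebra is finite dimensional).
\<close>

definition dlegs :: "('k::field, 'a::ring_1) hopf \<Rightarrow> nat \<Rightarrow> ('a list \<Rightarrow> 'k) \<Rightarrow> (nat \<Rightarrow> 'a \<Rightarrow> 'k) list" where
  "dlegs H n F = map (\<lambda>p i. p ! (i - 1))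
     (SOME ps. set ps \<subseteq> nlists n (dual H) \<and>
        (\<forall>v\<in>nlists n UNIV. F v = (\<Sum>p\<leftarrow>ps. \<Prod>i<n. (p ! i) (v ! i))))"

definition dcomult :: "('k::field, 'a::ring_1) hopf \<Rightarrow> ('a \<Rightarrow> 'k) \<Rightarrow> (nat \<Rightarrow> 'a \<Rightarrow> 'k) list" where
  "dcomult H f = dlegs H 2 (\<lambda>v. f (v ! 0 * v ! 1))"

subsection \<open>The underlying space\<close>

type_synonym ('k, 'a) double = "(('a \<Rightarrow> 'k) \<times> 'a \<Rightarrow> 'k) \<Rightarrow> 'k"

definition dforms :: "('k::field, 'a::ring_1) hopf \<Rightarrow> (('a \<Rightarrow> 'k) \<times> 'a \<Rightarrow> 'k) set" where
  "dforms H =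
    {m. (\<forall>f x. f \<notin> dual H \<longrightarrow> m (f, x) = 0) \<and>
        (\<forall>f\<in>dual H. Vector_Spaces.linear (smult H) (*) (\<lambda>x. m (f, x))) \<and>
        (\<forall>f\<in>dual H. \<forall>g\<in>dual H. \<forall>c x.
           m (f + g, x) = m (f, x) + m (g, x) \<and> m (fscale c f, x) = c * m (f, x))}"

definition dten :: "('k::field, 'a::ring_1) hopf \<Rightarrow> ('a \<Rightarrow> 'k) \<Rightarrow> 'a \<Rightarrow> ('k, 'a) double" where
  "dten H f x = pure_tensor (dforms H) (f, x)"

definition double_space :: "('k::field, 'a::ring_1) hopf \<Rightarrow> ('k, 'a) double set" where
  "double_space H = tensors (dforms H) (dual H \<times> UNIV)"

definition double_ext ::
  "('k::field, 'a::ring_1) hopf \<Rightarrow> (('a \<Rightarrow> 'k) \<Rightarrow> 'a \<Rightarrow> 'v::monoid_add) \<Rightarrow> ('k, 'a) double \<Rightarrow> 'v" where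
  "double_ext H F = lin_ext (dforms H) (dual H \<times> UNIV) (\<lambda>(f, x). F f x)"

text \<open>Pure tensors in the \<open>n\<close>-th tensor power of the double.\<close>

definition dtens ::
  "('k::field, 'a::ring_1) hopf \<Rightarrow> nat \<Rightarrow> ('k, 'a) double list \<Rightarrow> (('k, 'a) double list \<Rightarrow> 'k) \<Rightarrow> 'k" where
  "dtens H n = pure_tensor (mult_forms fscale (double_space H) n)"

subsection \<open>The deformed structure\<close>

record ('k, 'd) quasi_hopf =
  qspace :: "'d set"
  qmult :: "'d \<Rightarrow> 'd \<Rightarrow> 'd"
  qunit :: "'d"
  qcomult :: "'d \<Rightarrow> ('d list \<Rightarrow> 'k) \<Rightarrow> 'k"
  qcounit :: "'d \<Rightarrow> 'k"
  qantipode :: "'d \<Rightarrow> 'd"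
  qassociator :: "('d list \<Rightarrow> 'k) \<Rightarrow> 'k"
  qalpha :: "'d"
  qbeta :: "'d"

definition double_mult ::
  "('k::field, 'a::ring_1) hopf \<Rightarrow> ('a list \<Rightarrow> 'a list \<Rightarrow> 'k)
     \<Rightarrow> ('k, 'a) double \<Rightarrow> ('k, 'a) double \<Rightarrow> ('k, 'a) double" where
  "double_mult H \<theta> s t =
     double_ext H (\<lambda>f x. double_ext H (\<lambda>g y.
       \<Sum>x\<leftarrow>legs H 4 x. \<Sum>y\<leftarrow>legs H 2 y.
         dten H
           (dmult H (dmult H f (lact (x 1) (ract g (antipode H (x 2)))))
                    (\<lambda>a. \<theta> [x 3, y 1] [a]))
           (x 4 * y 2)) t) s"

definition double_comult ::
  "('k::field, 'a::ring_1) hopf \<Rightarrow> ('a list \<Rightarrow> 'a list \<Rightarrow> 'k)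
     \<Rightarrow> ('k, 'a) double \<Rightarrow> (('k, 'a) double list \<Rightarrow> 'k) \<Rightarrow> 'k" where
  "double_comult H \<gamma> =
     double_ext H (\<lambda>f x. \<Sum>x\<leftarrow>legs H 3 x. \<Sum>f\<leftarrow>dcomult H f. \<Sum>g\<leftarrow>dlegs H 2 (\<gamma> [x 1]).
       dtens H 2 [dten H (dmult H (f 1) (g 1)) (x 2), dten H (dmult H (f 2) (g 2)) (x 3)])"

definition double_antipode ::
  "('k::field, 'a::ring_1) hopf \<Rightarrow> ('a list \<Rightarrow> 'a list \<Rightarrow> 'k) \<Rightarrow> ('a list \<Rightarrow> 'a list \<Rightarrow> 'k)
     \<Rightarrow> ('k, 'a) double \<Rightarrow> ('k, 'a) double" where
  "double_antipode H \<gamma> \<theta> =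
     (let \<gamma>' = inv\<^bsub>C_grp H 1 2\<^esub> \<gamma>; \<theta>' = inv\<^bsub>C_grp H 2 1\<^esub> \<theta> in
      double_ext H (\<lambda>f x. \<Sum>x\<leftarrow>legs H 4 x. \<Sum>g\<leftarrow>dlegs H 2 (\<gamma>' [x 4]).
        double_mult H \<theta>
          (dten H (counit H) (antipode H (x 1)))
          (dten H
            (dmult H (dmult H (\<lambda>a. \<theta>' [x 2, antipode H (x 3)] [a]) (dantipode H (dmult H f (g 1))))
                     (g 2))
            1)))"

definition double_structure ::
  "('k::field, 'a::ring_1) hopf \<Rightarrow> ('a list \<Rightarrow> 'k) \<Rightarrow> ('a list \<Rightarrow> 'a list \<Rightarrow> 'k)
     \<Rightarrow> ('a list \<Rightarrow> 'a list \<Rightarrow> 'k) \<Rightarrow> ('k, ('k, 'a) double) quasi_hopf" where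
  "double_structure H w \<gamma> \<theta> =
     \<lparr>qspace = double_space H,
      qmult = double_mult H \<theta>,
      qunit = dten H (counit H) 1,
      qcomult = double_comult H \<gamma>,
      qcounit = double_ext H (\<lambda>f x. f 1 * counit H x),
      qantipode = double_antipode H \<gamma> \<theta>,
      qassociator = (\<Sum>v\<leftarrow>dlegs H 3 (inv\<^bsub>Reg H 3\<^esub> w).
        dtens H 3 [dten H (v 1) 1, dten H (v 2) 1, dten H (v 3) 1]),
      qalpha = dten H (counit H) 1,
      qbeta = (\<Sum>v\<leftarrow>dlegs H 3 w.
        dten H (dmult H (dmult H (v 1) (dantipode H (v 2))) (v 3)) 1)\<rparr>"

type_synonym ('k, 'a) datum =
  "('a list \<Rightarrow> 'k) \<times> ('a list \<Rightarrow> 'a list \<Rightarrow> 'k) \<times> ('a list \<Rightarrow> 'a list \<Rightarrow> 'k) \<times> ('a list \<Rightarrow> 'k)"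

text \<open>The quadruples \<open>(w, \<gamma>, \<theta>, w\<^sub>1)\<close> by which the double can be deformed.\<close>

definition deformation_data :: "('k::field, 'a::ring_1) hopf \<Rightarrow> ('k, 'a) datum set" where
  "deformation_data H = Reg_N H 3 \<times> C_N H 1 2 \<times> C_N H 2 1 \<times> Reg_N H 3"

definition deformed_double ::
  "('k::field, 'a::ring_1) hopf \<Rightarrow> ('k, 'a) datum \<Rightarrow> ('k, ('k, 'a) double) quasi_hopf" where
  "deformed_double H = (\<lambda>(w, \<gamma>, \<theta>, w1). double_structure H w \<gamma> \<theta>)"

text \<open>
  The image \<open>(f\<^sub>0, f\<^sub>1, f\<^sub>2, f\<^sub>3)\<close> of an element of degree 3; in \<open>f\<^sub>0\<close> and \<open>f\<^sub>3\<close> the argument in the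
  zeroth tensor power is dropped.
\<close>

definition hs_image3 :: "('k::field, 'a::ring_1) hopf \<Rightarrow> ('a list \<Rightarrow> 'k) \<Rightarrow> ('k, 'a) datum" where
  "hs_image3 H w =
     (hs_component H 3 w 0 [], hs_component H 3 w 1, hs_component H 3 w 2,
      (\<lambda>a. hs_component H 3 w 3 a []))"


section \<open>The constructions of Dijkgraaf--Pasquier--Roche and Bulacu--Panaite\<close>

definition bp_theta :: "('k::field, 'a::ring_1) hopf \<Rightarrow> ('a list \<Rightarrow> 'k) \<Rightarrow> 'a list \<Rightarrow> 'a list \<Rightarrow> 'k" where
  "bp_theta H w = (\<lambda>a b. if length a = 2 \<and> length b = 1 then
     (let w' = inv\<^bsub>Reg H 3\<^esub> w in
      \<Sum>x\<leftarrow>legs H 5 (a ! 0). \<Sum>y\<leftarrow>legs H 4 (a ! 1). \<Sum>z\<leftarrow>legs H 3 (b ! 0).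
        w [z 1, x 1, y 1] * w' [x 2, adj H (x 3) (z 2), y 2] * w [x 4, y 3, adj H (x 5 * y 4) (z 3)])
     else 0)"

definition bp_gamma :: "('k::field, 'a::ring_1) hopf \<Rightarrow> ('a list \<Rightarrow> 'k) \<Rightarrow> 'a list \<Rightarrow> 'a list \<Rightarrow> 'k" where
  "bp_gamma H w = (\<lambda>a b. if length a = 1 \<and> length b = 2 then
     (let w' = inv\<^bsub>Reg H 3\<^esub> w in
      \<Sum>z\<leftarrow>legs H 6 (a ! 0). \<Sum>x\<leftarrow>legs H 3 (b ! 0). \<Sum>y\<leftarrow>legs H 3 (b ! 1).
        w [x 1, y 1, z 1] * w' [x 2, z 2, adj H (z 3) (y 2)]
          * w [z 4, adj H (z 5) (x 3), adj H (z 6) (y 3)])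
     else 0)"

definition dpr_bp_double ::
  "('k::field, 'a::ring_1) hopf \<Rightarrow> ('a list \<Rightarrow> 'k) \<Rightarrow> ('k, ('k, 'a) double) quasi_hopf" where
  "dpr_bp_double H w = double_structure H w (bp_gamma H w) (bp_theta H w)"

end

theory Submission
  imports Defs
begin

text \<open>
  Precomposition with \<open>\<sigma>\<^sub>i\<close> is an endomorphism of the convolution group, because
  \<open>\<sigma>\<close> is a morphism of coalgebras when the Hopf algebra is cocommutative; it also preserves
  normalization.  In degree 3 there are at most three shuffles for each \<open>p\<close>, so that the components
  of the image of \<open>w\<close> are \<open>w\<close>, the triple products
  \<open>w * (w\<^sup>-\<^sup>1 \<circ> \<sigma>\<^sub>2) * (w \<circ> \<sigma>\<^sub>1\<sigma>\<^sub>2)\<close> and \<open>w * (w\<^sup>-\<^sup>1 \<circ> \<sigma>\<^sub>1) * (w \<circ> \<sigma>\<^sub>2\<sigma>\<^sub>1)\<close>,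
  and \<open>w\<close>.  By coassociativity and \<open>ad\<^sub>x\<^sub>y = ad\<^sub>y \<circ> ad\<^sub>x\<close> the two products are
  \<open>\<gamma>\<close> and \<open>\<theta>\<close>.\<close>

section \<open>Sweedler sums and multilinear forms\<close>

text \<open>Presentations of coproducts are chosen arbitrarily, so rearranging the legs of one
  element is legitimate only when the summand is linear in each leg. This shapes the whole proof.
  Identities in the algebra are tested on linear forms, which makes all sums scalar, and each
  regrouping, exchange or cancellation of legs carries linearity conditions, discharged by the rules
  collected in \<open>lin_intros\<close> and \<open>lin_intros'\<close>. Interchanging sums over
  different elements, by contrast, is free.

  Sums with many legs are unfolded into nested binary sums that always split the last leg;
  convolution and braiding produce other groupings, which coassociativity brings to this one. Forms
  of any arity are treated by fixing the first argument, under which convolution, counit and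
  braiding all recurse.

  Cocommutativity serves two purposes: it makes the convolution groups commutative, so that a
  product over an unordered set of shuffles makes sense, and it compensates for the antipode
  reversing coproducts in the adjoint action. Reduced words are also given by a choice, so those
  that occur must be shown to be unique.\<close>

lemma sum_list_swap:
  "(\<Sum>x\<leftarrow>xs. \<Sum>y\<leftarrow>ys. F x y) = (\<Sum>y\<leftarrow>ys. \<Sum>x\<leftarrow>xs. (F x y :: 'b::comm_monoid_add))"
  by (induction xs) (auto simp: sum_list_addf)

lemma sum_list_concat_map:
  "(\<Sum>x\<leftarrow>concat (map f xs). g x) = (\<Sum>x\<leftarrow>xs. \<Sum>y\<leftarrow>f x. (g y :: 'b::monoid_add))"
  by (induction xs) auto

lemma sum_list_apply: "(\<Sum>x\<leftarrow>xs. F x) m = (\<Sum>x\<leftarrow>xs. F x m)"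
  by (induction xs) (auto simp: plus_fun_def zero_fun_def)

lemma mult_forms_UNIV:
  "m \<in> mult_forms s UNIV n \<longleftrightarrow>
     (\<forall>v. length v \<noteq> n \<longrightarrow> m v = 0) \<and>
     (\<forall>v x y c i. length v = n \<longrightarrow> i < n \<longrightarrow>
        m (v[i := x + y]) = m (v[i := x]) + m (v[i := y]) \<and>
        m (v[i := s c x]) = c * m (v[i := x]))"
  unfolding mult_forms_def by (auto simp: in_nlists_UNIV)

context
  fixes H :: "('k::field, 'a::ring_1) hopf"
begin

text \<open>All longer Sweedler sums are built from this one by nesting. Independence of the
  presentation behind \<open>legs\<close> is available for scalar-valued bilinear \<open>G\<close>,
  see \<open>sw_comult\<close>.\<close>

definition sw :: "'a \<Rightarrow> ('a \<Rightarrow> 'a \<Rightarrow> 'b::comm_monoid_add) \<Rightarrow> 'b" where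
  "sw a G = (\<Sum>x\<leftarrow>legs H 2 a. G (x 1) (x 2))"

lemma sw_terms: "sw a G = (\<Sum>p\<leftarrow>terms (forms H 2) (nlists 2 UNIV) (comult H a). G (p ! 0) (p ! 1))"
  by (simp add: sw_def legs_def sum_list_concat_map comp_def numeral_2_eq_2)

text \<open>\<open>iter_comult\<close> always splits the last leg, hence the nesting to the right.
  The indices 0 and 1 coincide because subtraction on \<open>nat\<close> stops at 0; this is the
  origin of the test \<open>i \<le> 1\<close>.\<close>

lemma legs_Suc:
  "(\<Sum>x\<leftarrow>legs H (Suc (Suc k)) a. F x) =
   sw a (\<lambda>b c. \<Sum>x\<leftarrow>legs H (Suc k) c. (F (\<lambda>i. if i \<le> 1 then b else x (i - 1)) :: 'b::comm_monoid_add))"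
proof -
  have *: "(\<lambda>i. (b # v) ! (i - 1)) = (\<lambda>i. if i \<le> 1 then b else v ! (i - 1 - 1))" for b and v :: "'a list"
  proof
    fix i show "(b # v) ! (i - 1) = (if i \<le> 1 then b else v ! (i - 1 - 1))"
      by (cases i; cases "i - 1") auto
  qed
  show ?thesis
    by (simp add: sw_terms legs_def sum_list_concat_map comp_def * del: One_nat_def)
qed

lemma legs_1: "(\<Sum>x\<leftarrow>legs H (Suc 0) a. F x) = F (\<lambda>i. [a] ! (i - 1))"
  by (simp add: legs_def)

lemma sw_add: "sw a (\<lambda>b c. F b c + G b c) = sw a F + sw a G"
  by (simp add: sw_def sum_list_addf)

lemma sw_zero [simp]: "sw a (\<lambda>b c. 0) = 0"
  by (simp add: sw_def)

lemma sw_mult_left: "sw a (\<lambda>b c. r * F b c) = (r :: 'b::semiring_0) * sw a F"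
  by (simp add: sw_def sum_list_const_mult)

lemma sw_mult_right: "sw a (\<lambda>b c. F b c * r) = sw a F * (r :: 'b::semiring_0)"
  by (simp add: sw_def sum_list_mult_const)

lemma sw_swap: "sw a (\<lambda>b c. sw d (F b c)) = sw d (\<lambda>e f. sw a (\<lambda>b c. F b c e f))"
  by (simp add: sw_def) (rule sum_list_swap)

lemma sw_sum_list: "sw a (\<lambda>b c. \<Sum>x\<leftarrow>xs. F x b c) = (\<Sum>x\<leftarrow>xs. sw a (F x))"
  by (simp add: sw_def) (rule sum_list_swap)

text \<open>Linearity is spelled out so that multilinear forms can be handled before any vector
  space axiom is available; \<open>lin_iff\<close> and \<open>elin_iff\<close> make the link with
  \<open>Vector_Spaces.linear\<close>.\<close>

definition lin :: "('a \<Rightarrow> 'k) \<Rightarrow> bool" where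
  "lin f \<longleftrightarrow> (\<forall>x y. f (x + y) = f x + f y) \<and> (\<forall>c x. f (smult H c x) = c * f x)"

definition elin :: "('a \<Rightarrow> 'a) \<Rightarrow> bool" where
  "elin g \<longleftrightarrow> (\<forall>x y. g (x + y) = g x + g y) \<and> (\<forall>c x. g (smult H c x) = smult H c (g x))"

definition bilin :: "('a \<Rightarrow> 'a \<Rightarrow> 'k) \<Rightarrow> bool" where
  "bilin G \<longleftrightarrow> (\<forall>b. lin (\<lambda>a. G a b)) \<and> (\<forall>a. lin (\<lambda>b. G a b))"

lemma bilinI: "(\<And>b. lin (\<lambda>a. G a b)) \<Longrightarrow> (\<And>a. lin (\<lambda>b. G a b)) \<Longrightarrow> bilin G"
  by (simp add: bilin_def)

lemma lin_comp: "lin f \<Longrightarrow> elin g \<Longrightarrow> lin (\<lambda>x. f (g x))"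
  by (simp add: lin_def elin_def)

lemma lin_mult_left: "lin f \<Longrightarrow> lin (\<lambda>x. r * f x)"
  by (simp add: lin_def algebra_simps)

lemma lin_mult_right: "lin f \<Longrightarrow> lin (\<lambda>x. f x * r)"
  by (simp add: lin_def algebra_simps)

text \<open>The presentation belongs to \<open>a\<close> and does not vary with \<open>x\<close>, so
  linearity passes through the finite sum term by term. In \<open>lin_sw_arg\<close> the element
  being split varies, which is harder.\<close>

lemma lin_sw_inner: "(\<And>b c. lin (\<lambda>x. F x b c)) \<Longrightarrow> lin (\<lambda>x. sw a (F x))"
  unfolding lin_def sw_add[symmetric] sw_mult_left[symmetric]
  by (intro conjI allI arg_cong[of _ _ "sw a"] ext) simp_all

lemma elin_id: "elin (\<lambda>x. x)"
  by (simp add: elin_def)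

lemma forms_off_length: "f \<in> forms H n \<Longrightarrow> length v \<noteq> n \<Longrightarrow> f v = 0"
  by (simp add: forms_def mult_forms_UNIV)

lemma forms_eqI:
  "f \<in> forms H n \<Longrightarrow> g \<in> forms H n \<Longrightarrow> (\<And>v. length v = n \<Longrightarrow> f v = g v) \<Longrightarrow> f = g"
  using forms_off_length by (intro ext) metis

lemma forms_0: "f \<in> forms H 0 \<longleftrightarrow> (\<forall>v. v \<noteq> [] \<longrightarrow> f v = 0)"
  by (auto simp: forms_def mult_forms_UNIV)

text \<open>Currying in the first argument. It turns statements about \<open>n\<close>-linear forms
  into inductions on \<open>n\<close> or on the argument list, each step costing one linearity
  check.\<close>

lemma forms_Suc:
  "f \<in> forms H (Suc n) \<longleftrightarrow>
     f [] = 0 \<and> (\<forall>a. (\<lambda>v. f (a # v)) \<in> forms H n) \<and> (\<forall>v. lin (\<lambda>a. f (a # v)))"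
  (is "?L \<longleftrightarrow> ?R")
proof
  assume L: ?L
  have off: "length v \<noteq> Suc n \<Longrightarrow> f v = 0" for v
    using L by (rule forms_off_length)
  have upd: "f (v[i := x + y]) = f (v[i := x]) + f (v[i := y]) \<and> f (v[i := smult H c x]) = c * f (v[i := x])"
    if "length v = Suc n" "i < Suc n" for v i x y c
    using L that unfolding forms_def mult_forms_UNIV by blast
  have "(\<lambda>v. f (a # v)) \<in> forms H n" for a
    unfolding forms_def mult_forms_UNIV
  proof (intro conjI allI impI)
    fix v :: "'a list" and x y c i assume "length v = n" "i < n"
    then show "f (a # v[i := x + y]) = f (a # v[i := x]) + f (a # v[i := y])"
      and "f (a # v[i := smult H c x]) = c * f (a # v[i := x])"
      using upd[of "a # v" "Suc i"] by auto
  qed (simp add: off)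
  moreover have "lin (\<lambda>a. f (a # v))" for v
  proof (cases "length v = n")
    case True
    then show ?thesis using upd[of "0 # v" 0] by (simp add: lin_def)
  qed (simp add: lin_def off)
  ultimately show ?R using off by simp
next
  assume R: ?R
  have off: "f v = 0" if "length v \<noteq> Suc n" for v
    using R that by (cases v) (auto intro: forms_off_length)
  show ?L
    unfolding forms_def mult_forms_UNIV
  proof (intro conjI allI impI)
    fix v :: "'a list" and x y c i assume v: "length v = Suc n" "i < Suc n"
    then obtain a u where u: "v = a # u" "length u = n" by (cases v) auto
    have 1: "(\<lambda>v. f (a # v)) \<in> mult_forms (smult H) UNIV n" using R by (simp add: forms_def)
    have 2: "lin (\<lambda>a. f (a # u))" using R by blast
    show "f (v[i := x + y]) = f (v[i := x]) + f (v[i := y])"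
      using 1 2 u v unfolding mult_forms_UNIV by (cases i) (auto simp: lin_def)
    show "f (v[i := smult H c x]) = c * f (v[i := x])"
      using 1 2 u v unfolding mult_forms_UNIV by (cases i) (auto simp: lin_def)
  qed (use off in auto)
qed

lemma zero_form: "(\<lambda>v. 0) \<in> forms H n"
  by (simp add: forms_def mult_forms_UNIV)

lemma forms_add: "f \<in> forms H n \<Longrightarrow> g \<in> forms H n \<Longrightarrow> (\<lambda>v. f v + g v) \<in> forms H n"
  by (auto simp: forms_def mult_forms_UNIV algebra_simps)

lemma forms_sum_list: "(\<And>x. F x \<in> forms H n) \<Longrightarrow> (\<lambda>v. \<Sum>x\<leftarrow>xs. F x v) \<in> forms H n"
  by (induction xs) (auto intro: zero_form forms_add)

lemma forms_sw: "(\<And>b c. F b c \<in> forms H n) \<Longrightarrow> (\<lambda>v. sw a (\<lambda>b c. F b c v)) \<in> forms H n"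
  unfolding sw_def by (rule forms_sum_list)

lemma forms_Cons: "f \<in> forms H (Suc n) \<Longrightarrow> (\<lambda>v. f (a # v)) \<in> forms H n"
  by (simp add: forms_Suc)

lemma lin_form_1: "f \<in> forms H (Suc n) \<Longrightarrow> elin g \<Longrightarrow> lin (\<lambda>x. f (g x # v))"
  by (rule lin_comp[of "\<lambda>x. f (x # v)"]) (auto simp: forms_Suc)

lemma lin_form_2: "f \<in> forms H (Suc (Suc n)) \<Longrightarrow> elin g \<Longrightarrow> lin (\<lambda>x. f (a # g x # v))"
  by (rule lin_form_1[of "\<lambda>v. f (a # v)"]) (auto simp: forms_Suc)

lemma lin_form_3: "f \<in> forms H (Suc (Suc (Suc n))) \<Longrightarrow> elin g \<Longrightarrow> lin (\<lambda>x. f (a # b # g x # v))"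
  by (rule lin_form_2[of "\<lambda>v. f (a # v)"]) (auto simp: forms_Suc)

lemma bilin_form:
  assumes "bilin G"
  shows "(\<lambda>v. if length v = 2 then G (v ! 0) (v ! 1) else 0) \<in> forms H 2"
proof -
  have lin: "lin (\<lambda>a. G a b)" "lin (G a)" for a b
    using assms by (auto simp: bilin_def)
  then have "lin (\<lambda>b. if P then G a b else 0)" "lin (\<lambda>a. if P then G a b else 0)" for P a b
    by (auto simp: lin_def)
  then show ?thesis
    by (simp add: numeral_2_eq_2 forms_Suc forms_0 cong: if_cong)
qed

section \<open>Presentations of tensors by pure ones\<close>

lemma terms_tensor:
  assumes "t \<in> tensors M P"
  shows "set (terms M P t) \<subseteq> P" "t = (\<Sum>p\<leftarrow>terms M P t. pure_tensor M p)"
proof -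
  have "\<exists>ps. set ps \<subseteq> P \<and> t = (\<Sum>p\<leftarrow>ps. pure_tensor M p)"
    using assms by (auto simp: tensors_def)
  then have "set (terms M P t) \<subseteq> P \<and> t = (\<Sum>p\<leftarrow>terms M P t. pure_tensor M p)"
    unfolding terms_def by (rule someI_ex)
  then show "set (terms M P t) \<subseteq> P" "t = (\<Sum>p\<leftarrow>terms M P t. pure_tensor M p)" by auto
qed

text \<open>A tensor is itself a functional on forms, so summing a form over any presentation
  evaluates the tensor at that form, and the choice made by \<open>terms\<close> disappears.\<close>

lemma sum_terms:
  assumes "t \<in> tensors M P" "m \<in> M"
  shows "(\<Sum>p\<leftarrow>terms M P t. m p) = t m"
proof -
  have "t m = (\<Sum>p\<leftarrow>terms M P t. pure_tensor M p) m"
    using terms_tensor(2)[OF assms(1)] by simp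
  then show ?thesis using assms(2) by (simp add: sum_list_apply pure_tensor_def)
qed

end

section \<open>The Hopf algebra axioms as rules for Sweedler sums\<close>

context hopf_algebra
begin

abbreviation "\<Delta> \<equiv> sw H"
abbreviation "\<epsilon> \<equiv> counit H"
abbreviation "S \<equiv> antipode H"
abbreviation "ad \<equiv> adj H"

sublocale vs: vector_space "smult H"
  by (rule vector_space)

lemma module_scalars: "module ((*) :: 'k \<Rightarrow> 'k \<Rightarrow> 'k)"
  by unfold_locales (auto simp: algebra_simps)

lemma lin_iff: "lin H f \<longleftrightarrow> Vector_Spaces.linear (smult H) (*) f"
  by (simp add: linear_iff_module_hom module_hom_iff module_scalars vs.module_axioms lin_def)

lemma elin_iff: "elin H f \<longleftrightarrow> Vector_Spaces.linear (smult H) (smult H) f"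
  by (simp add: linear_iff_module_hom module_hom_iff vs.module_axioms elin_def)

text \<open>Over a field, a nonzero vector is independent, so some linear form takes the value 1 on
  it. The rules for regrouping legs concern scalar sums; this lemma carries their consequences back
  to the algebra.\<close>

lemma lin_separates:
  assumes "\<And>f. lin H f \<Longrightarrow> f x = f y"
  shows "x = y"
proof (rule ccontr)
  interpret vector_space_pair "smult H" "(*) :: 'k \<Rightarrow> 'k \<Rightarrow> 'k"
    by unfold_locales (auto simp: algebra_simps)
  assume "x \<noteq> y"
  then have "vs.independent {x - y}" by simp
  then obtain f where f: "Vector_Spaces.linear (smult H) (*) f" "f (x - y) = (1::'k)"
    using linear_independent_extend[of "{x - y}" "\<lambda>_. 1"] by auto
  then have "f x \<noteq> f y"
    using linear_diff[OF f(1), of x y] by auto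
  then show False using assms f(1) lin_iff by blast
qed

lemma
  assumes "lin H f"
  shows lin_plus: "f (x + y) = f x + f y" and lin_smult: "f (smult H c x) = c * f x"
  using assms by (auto simp: lin_def)

lemma lin_0: "lin H f \<Longrightarrow> f 0 = 0"
  using lin_smult[of f 0 0] by simp

lemma lin_sum_list: "lin H f \<Longrightarrow> f (\<Sum>x\<leftarrow>xs. g x) = (\<Sum>x\<leftarrow>xs. f (g x))"
  by (induction xs) (auto simp: lin_plus lin_0)

lemma lin_sw: "lin H f \<Longrightarrow> f (\<Delta> a G) = \<Delta> a (\<lambda>b c. f (G b c))"
  by (simp add: sw_def lin_sum_list)

lemma lin_counit: "lin H \<epsilon>"
  using counit_linear by (simp add: lin_iff)

lemma elinI: "(\<And>f. lin H f \<Longrightarrow> lin H (\<lambda>x. f (g x))) \<Longrightarrow> elin H g"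
  unfolding elin_def by (intro conjI allI; rule lin_separates) (auto simp: lin_def)

lemma elin_mult_left: "elin H g \<Longrightarrow> elin H (\<lambda>x. c * g x)"
  by (simp add: elin_def distrib_left smult_mult_right)

lemma elin_mult_right: "elin H g \<Longrightarrow> elin H (\<lambda>x. g x * c)"
  by (simp add: elin_def distrib_right smult_mult_left)

lemma elin_antipode: "elin H g \<Longrightarrow> elin H (\<lambda>x. S (g x))"
  using antipode_linear by (simp add: elin_iff[symmetric]) (simp add: elin_def)

lemma sw_comult:
  assumes "bilin H G"
  shows "\<Delta> a G = comult H a (\<lambda>v. if length v = 2 then G (v ! 0) (v ! 1) else 0)"
proof -
  let ?m = "\<lambda>v. if length v = 2 then G (v ! 0) (v ! 1) else 0"
  have "\<Delta> a G = (\<Sum>p\<leftarrow>terms (forms H 2) (nlists 2 UNIV) (comult H a). ?m p)"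
    unfolding sw_terms using terms_tensor(1)[OF comult_tensor, of a]
    by (intro arg_cong[of _ _ sum_list] map_cong) (auto simp: in_nlists_UNIV)
  also have "\<dots> = comult H a ?m"
    by (rule sum_terms[OF comult_tensor bilin_form[OF assms]])
  finally show ?thesis .
qed

text \<open>The presentations for \<open>x\<close>, \<open>y\<close> and \<open>x + y\<close> are
  chosen separately and need not be related. Bilinearity of \<open>G\<close> allows
  \<open>sw_comult\<close> to remove them, and then linearity of the coproduct applies.\<close>

lemma lin_sw_arg:
  assumes "\<And>b. lin H (\<lambda>a. G a b)" "\<And>a. lin H (\<lambda>b. G a b)" "elin H g"
  shows "lin H (\<lambda>x. \<Delta> (g x) G)"
proof (rule lin_comp[where f = "\<lambda>x. \<Delta> x G", OF _ assms(3)])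
  have "module_hom (smult H) fscale (comult H)"
    using comult_linear by (simp add: linear_iff_module_hom)
  then show "lin H (\<lambda>x. \<Delta> x G)"
    unfolding lin_def sw_comult[OF bilinI[of H G, OF assms(1,2)]]
    by (simp add: module_hom_iff fscale_def plus_fun_def)
qed

lemmas lin_intros = lin_mult_left lin_mult_right lin_sw_inner lin_sw_arg elin_id elin_mult_left
  elin_mult_right elin_antipode lin_comp[OF lin_counit]

text \<open>Both sides of the axiom \<open>coassoc\<close> are functionals on trilinear forms, here
  evaluated at \<open>T\<close>. The rules \<open>sw_mult\<close>, \<open>sw_one\<close> and
  \<open>sw_cocomm\<close> arise from their axioms in the same way.\<close>

lemma sw_coassoc:
  assumes lin: "\<And>b c. lin H (\<lambda>a. T a b c)" "\<And>a c. lin H (\<lambda>b. T a b c)" "\<And>a b. lin H (\<lambda>c. T a b c)"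
  shows "\<Delta> x (\<lambda>b c. \<Delta> b (\<lambda>p q. T p q c)) = \<Delta> x (\<lambda>b c. \<Delta> c (\<lambda>q r. T b q r))"
proof -
  let ?m = "\<lambda>v. if length v = 3 then T (v ! 0) (v ! 1) (v ! 2) else 0"
  have m: "?m \<in> forms H 3"
    using lin by (auto simp: numeral_3_eq_3 forms_Suc forms_0 lin_def cong: if_cong)
  have "(\<Sum>p\<leftarrow>legs H 2 x. \<Sum>q\<leftarrow>legs H 2 (p 2). tens H 3 [p 1, q 1, q 2] ?m) =
                  (\<Sum>p\<leftarrow>legs H 2 x. \<Sum>q\<leftarrow>legs H 2 (p 1). tens H 3 [q 1, q 2, p 2] ?m)"
    using fun_cong[OF coassoc[of x], of ?m] by (simp add: sum_list_apply)
  then show ?thesis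
    using m by (simp add: tens_def pure_tensor_def sw_def)
qed

lemma sw_counit_left: "lin H f \<Longrightarrow> \<Delta> x (\<lambda>b c. \<epsilon> b * f c) = f x"
  using arg_cong[OF counit_left[of x], of f] by (simp add: lin_sum_list lin_smult sw_def)

lemma sw_counit_right: "lin H f \<Longrightarrow> \<Delta> x (\<lambda>b c. \<epsilon> c * f b) = f x"
  using arg_cong[OF counit_right[of x], of f] by (simp add: lin_sum_list lin_smult sw_def)

lemma sw_mult:
  assumes "\<And>b. lin H (\<lambda>a. G a b)" "\<And>a. lin H (\<lambda>b. G a b)"
  shows "\<Delta> (x * y) G = \<Delta> x (\<lambda>a b. \<Delta> y (\<lambda>c d. G (a * c) (b * d)))"
proof -
  let ?m = "\<lambda>v. if length v = 2 then G (v ! 0) (v ! 1) else 0"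
  have "\<Delta> (x * y) G = comult H (x * y) ?m"
    by (rule sw_comult[OF bilinI[of H G, OF assms]])
  also have "\<dots> = \<Delta> x (\<lambda>a b. \<Delta> y (\<lambda>c d. G (a * c) (b * d)))"
    using bilin_form[OF bilinI[of H G, OF assms]]
    by (simp add: comult_mult sum_list_apply tens_def pure_tensor_def sw_def)
  finally show ?thesis .
qed

lemma sw_one:
  assumes "\<And>b. lin H (\<lambda>a. G a b)" "\<And>a. lin H (\<lambda>b. G a b)"
  shows "\<Delta> 1 G = G 1 1"
  using bilin_form[OF bilinI[of H G, OF assms]]
  by (simp add: sw_comult[OF bilinI[of H G, OF assms]] comult_one tens_def pure_tensor_def)

lemma sw_antipode_left:
  "lin H f \<Longrightarrow> \<Delta> x (\<lambda>b c. f (S b * c)) = \<epsilon> x * f 1"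
  using arg_cong[OF antipode_left[of x], of f] by (simp add: lin_sum_list lin_smult sw_def)

lemma sw_antipode_right:
  "lin H f \<Longrightarrow> \<Delta> x (\<lambda>b c. f (b * S c)) = \<epsilon> x * f 1"
  using arg_cong[OF antipode_right[of x], of f] by (simp add: lin_sum_list lin_smult sw_def)

end

context fd_cocomm_hopf_algebra
begin

lemma sw_cocomm:
  assumes "\<And>b. lin H (\<lambda>a. G a b)" "\<And>a. lin H (\<lambda>b. G a b)"
  shows "\<Delta> x G = \<Delta> x (\<lambda>b c. G c b)"
proof -
  let ?m = "\<lambda>v. if length v = 2 then G (v ! 0) (v ! 1) else 0"
  have "\<Delta> x G = comult H x ?m" by (rule sw_comult[OF bilinI[of H G, OF assms]])
  also have "\<dots> = (\<Sum>p\<leftarrow>legs H 2 x. tens H 2 [p 2, p 1] ?m)"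
    using fun_cong[OF cocomm[of x], of ?m] by (simp add: sum_list_apply)
  also have "\<dots> = \<Delta> x (\<lambda>b c. G c b)"
    using bilin_form[OF bilinI[of H G, OF assms]] by (simp add: tens_def pure_tensor_def sw_def)
  finally show ?thesis .
qed

end

section \<open>Antipode and adjoint action\<close>

context hopf_algebra
begin

lemma sw_cong: "(\<And>b c. F b c = G b c) \<Longrightarrow> \<Delta> a F = \<Delta> a G"
  by (simp add: sw_def)

text \<open>Four legs grouped as (p q)(r s) are regrouped as p((q r)s). The middle legs thereby
  become the coproduct of one element, so that they can be cancelled by the antipode or, under
  cocommutativity, exchanged.\<close>

lemma sw_middle:
  assumes "\<And>q r s. lin H (\<lambda>p. L p q r s)" "\<And>p r s. lin H (\<lambda>q. L p q r s)"
    "\<And>p q s. lin H (\<lambda>r. L p q r s)" "\<And>p q r. lin H (\<lambda>s. L p q r s)"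
  shows "\<Delta> e (\<lambda>a c. \<Delta> a (\<lambda>p q. \<Delta> c (\<lambda>r s. L p q r s))) =
         \<Delta> e (\<lambda>p t. \<Delta> t (\<lambda>m s. \<Delta> m (\<lambda>q r. L p q r s)))"
proof -
  have "\<Delta> e (\<lambda>a c. \<Delta> a (\<lambda>p q. \<Delta> c (\<lambda>r s. L p q r s))) =
        \<Delta> e (\<lambda>p t. \<Delta> t (\<lambda>q c. \<Delta> c (\<lambda>r s. L p q r s)))"
    by (rule sw_coassoc) (intro lin_intros assms)+
  also have "\<dots> = \<Delta> e (\<lambda>p t. \<Delta> t (\<lambda>m s. \<Delta> m (\<lambda>q r. L p q r s)))"
    by (rule sw_cong, rule sw_coassoc[symmetric]) (intro assms)+
  finally show ?thesis .
qed

text \<open>Uniqueness of convolution inverses: on the tensor square, \<open>S (x * y)\<close> and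
  \<open>S y * S x\<close> both invert the product. The chain expands to S(y1) S(x1) x2 y2 S(x3 y3)
  and collapses it from the other end.\<close>

lemma antipode_mult: "S (x * y) = S y * S x"
proof (rule lin_separates)
  fix f assume f: "lin H f"
  note li = lin_intros lin_comp[OF f]
  \<comment> \<open>The right inverse, to be inserted behind \<open>t\<close>, which becomes S(y1)
    S(x1).\<close>
  have ins: "\<epsilon> p * (\<epsilon> q * f t) = \<Delta> p (\<lambda>a b. \<Delta> q (\<lambda>c d. f (t * (a * c * S (b * d)))))" for p q t
  proof -
    have "\<Delta> (p * q) (\<lambda>b c. f (t * (b * S c))) = \<epsilon> (p * q) * f (t * 1)"
      by (rule sw_antipode_right[where f = "\<lambda>u. f (t * u)"]) (intro li)
    moreover have "\<Delta> (p * q) (\<lambda>b c. f (t * (b * S c))) =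
        \<Delta> p (\<lambda>a b. \<Delta> q (\<lambda>c d. f (t * (a * c * S (b * d)))))"
      by (rule sw_mult) (intro li)+
    ultimately show ?thesis by (simp add: counit_mult)
  qed
  \<comment> \<open>The left inverse, cancelled from the inside: the legs of \<open>p\<close> meet
    first, then those of \<open>q\<close>.\<close>
  have con: "\<Delta> p (\<lambda>a b. \<Delta> q (\<lambda>c d. f (S c * S a * (b * d * t)))) = \<epsilon> p * (\<epsilon> q * f t)" for p q t
  proof -
    have "\<Delta> p (\<lambda>a b. \<Delta> q (\<lambda>c d. f (S c * S a * (b * d * t)))) =
          \<Delta> q (\<lambda>c d. \<Delta> p (\<lambda>a b. f (S c * (S a * b) * (d * t))))"
      by (subst sw_swap) (simp add: mult.assoc)
    also have "\<dots> = \<Delta> q (\<lambda>c d. \<epsilon> p * f (S c * 1 * (d * t)))"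
      by (rule sw_cong, rule sw_antipode_left[where f = "\<lambda>u. f (_ * u * _)"]) (intro li)
    also have "\<dots> = \<epsilon> p * \<Delta> q (\<lambda>c d. f ((S c * d) * t))"
      by (simp add: sw_mult_left mult.assoc)
    also have "\<Delta> q (\<lambda>c d. f ((S c * d) * t)) = \<epsilon> q * f (1 * t)"
      by (rule sw_antipode_left[where f = "\<lambda>u. f (u * _)"]) (intro li)
    finally show ?thesis by simp
  qed
  have "f (S y * S x) = \<Delta> x (\<lambda>x1 x2. \<epsilon> x2 * f (S y * S x1))"
    by (rule sw_counit_right[symmetric]) (intro li)
  also have "\<dots> = \<Delta> x (\<lambda>x1 x2. \<epsilon> x2 * \<Delta> y (\<lambda>y1 y2. \<epsilon> y2 * f (S y1 * S x1)))"
    by (intro arg_cong[of _ _ "\<Delta> x"] arg_cong[of _ _ "(*) _"] ext, rule sw_counit_right[symmetric])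
      (intro li)
  also have "\<dots> = \<Delta> x (\<lambda>x1 x2. \<Delta> y (\<lambda>y1 y2. \<Delta> x2 (\<lambda>a b. \<Delta> y2 (\<lambda>c d.
      f (S y1 * S x1 * (a * c * S (b * d)))))))"
    by (simp add: ins flip: sw_mult_left)
  also have "\<dots> = \<Delta> x (\<lambda>x1 x2. \<Delta> x2 (\<lambda>a b. \<Delta> y (\<lambda>y1 y2. \<Delta> y2 (\<lambda>c d.
      f (S y1 * S x1 * (a * c * S (b * d)))))))"
    by (subst sw_swap) (rule refl)
  also have "\<dots> = \<Delta> x (\<lambda>x1 x2. \<Delta> x1 (\<lambda>p q. \<Delta> y (\<lambda>y1 y2. \<Delta> y2 (\<lambda>c d.
      f (S y1 * S p * (q * c * S (x2 * d)))))))"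
    by (rule sw_coassoc[symmetric]) (intro li)+
  also have "\<dots> = \<Delta> x (\<lambda>x1 x2. \<Delta> x1 (\<lambda>p q. \<Delta> y (\<lambda>y1 y2. \<Delta> y1 (\<lambda>r s.
      f (S r * S p * (q * s * S (x2 * y2)))))))"
    by (rule sw_cong, rule sw_cong, rule sw_coassoc[symmetric]) (intro li)+
  also have "\<dots> = \<Delta> x (\<lambda>x1 x2. \<Delta> y (\<lambda>y1 y2. \<Delta> x1 (\<lambda>p q. \<Delta> y1 (\<lambda>r s.
      f (S r * S p * (q * s * S (x2 * y2)))))))"
    by (subst sw_swap) (rule refl)
  also have "\<dots> = \<Delta> x (\<lambda>x1 x2. \<epsilon> x1 * \<Delta> y (\<lambda>y1 y2. \<epsilon> y1 * f (S (x2 * y2))))"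
    by (simp add: con sw_mult_left)
  also have "\<dots> = \<Delta> x (\<lambda>x1 x2. \<epsilon> x1 * f (S (x2 * y)))"
    by (intro arg_cong[of _ _ "\<Delta> x"] arg_cong[of _ _ "(*) _"] ext, rule sw_counit_left) (intro li)
  also have "\<dots> = f (S (x * y))"
    by (rule sw_counit_left) (intro li)
  finally show "f (S (x * y)) = f (S y * S x)" ..
qed

text \<open>The same uniqueness argument for maps into the tensor square: the coproduct of S(x) and
  the sum of the pairs S(x2), S(x1) are both convolution inverse to the coproduct.\<close>

lemma sw_antipode:
  assumes G: "\<And>b. lin H (\<lambda>a. G a b)" "\<And>a. lin H (\<lambda>b. G a b)"
  shows "\<Delta> (S x) G = \<Delta> x (\<lambda>a b. G (S b) (S a))"
proof -
  note li = lin_intros lin_comp[OF G(1)] lin_comp[OF G(2)]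
  have ins: "\<epsilon> b * G u v =
    \<Delta> b (\<lambda>c d. \<Delta> c (\<lambda>r s. \<Delta> (S d) (\<lambda>y z. G (u * (r * y)) (v * (s * z)))))" for b u v
  proof -
    let ?K = "\<lambda>p q. G (u * p) (v * q)"
    have "\<Delta> b (\<lambda>c d. \<Delta> (c * S d) ?K) = \<epsilon> b * \<Delta> 1 ?K"
      by (rule sw_antipode_right[where f = "\<lambda>t. \<Delta> t ?K"]) (intro li)
    also have "\<Delta> 1 ?K = ?K 1 1" by (rule sw_one) (intro li)+
    finally have "\<epsilon> b * G u v = \<Delta> b (\<lambda>c d. \<Delta> (c * S d) ?K)" by simp
    also have "\<dots> = \<Delta> b (\<lambda>c d. \<Delta> c (\<lambda>r s. \<Delta> (S d) (\<lambda>y z. ?K (r * y) (s * z))))"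
      by (rule sw_cong, rule sw_mult) (intro li)+
    finally show ?thesis .
  qed
  \<comment> \<open>The antipode's leg \<open>q\<close> and the leg \<open>r\<close> are not yet
    legs of one element; \<open>sw_middle\<close> makes them so. Their cancellation leaves S(p)
    facing the last leg, which cancels in turn.\<close>
  have con: "\<Delta> e (\<lambda>a c. \<Delta> a (\<lambda>p q. \<Delta> c (\<lambda>r s. G (S q * (r * y)) (S p * (s * z))))) = \<epsilon> e * G y z"
    for e y z
  proof -
    have "\<Delta> e (\<lambda>a c. \<Delta> a (\<lambda>p q. \<Delta> c (\<lambda>r s. G (S q * (r * y)) (S p * (s * z))))) =
          \<Delta> e (\<lambda>p t. \<Delta> t (\<lambda>m s. \<Delta> m (\<lambda>q r. G (S q * (r * y)) (S p * (s * z)))))"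
      by (rule sw_middle) (intro li)+
    also have "\<dots> = \<Delta> e (\<lambda>p t. \<Delta> t (\<lambda>m s. \<Delta> m (\<lambda>q r. G ((S q * r) * y) (S p * (s * z)))))"
      by (simp add: mult.assoc)
    also have "\<dots> = \<Delta> e (\<lambda>p t. \<Delta> t (\<lambda>m s. \<epsilon> m * G (1 * y) (S p * (s * z))))"
      by (rule sw_cong, rule sw_cong, rule sw_antipode_left[where f = "\<lambda>u. G (u * _) _"]) (intro li)
    also have "\<dots> = \<Delta> e (\<lambda>p t. G (1 * y) (S p * (t * z)))"
      by (rule sw_cong, rule sw_counit_left) (intro li)
    also have "\<dots> = \<Delta> e (\<lambda>p t. G y ((S p * t) * z))"
      by (simp add: mult.assoc)
    also have "\<dots> = \<epsilon> e * G y (1 * z)"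
      by (rule sw_antipode_left[where f = "\<lambda>u. G _ (u * _)"]) (intro li)
    finally show ?thesis by simp
  qed
  have "\<Delta> x (\<lambda>a b. G (S b) (S a)) = \<Delta> x (\<lambda>a b. \<epsilon> b * \<Delta> a (\<lambda>p q. G (S q) (S p)))"
    by (rule sw_counit_right[symmetric]) (intro li)
  also have "\<dots> = \<Delta> x (\<lambda>a b. \<Delta> a (\<lambda>p q. \<Delta> b (\<lambda>c d. \<Delta> c (\<lambda>r s. \<Delta> (S d) (\<lambda>y z.
      G (S q * (r * y)) (S p * (s * z)))))))"
    by (simp add: ins flip: sw_mult_left)
  also have "\<dots> = \<Delta> x (\<lambda>a b. \<Delta> b (\<lambda>c d. \<Delta> a (\<lambda>p q. \<Delta> c (\<lambda>r s. \<Delta> (S d) (\<lambda>y z.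
      G (S q * (r * y)) (S p * (s * z)))))))"
    by (subst sw_swap) (rule refl)
  also have "\<dots> = \<Delta> x (\<lambda>e d. \<Delta> e (\<lambda>a c. \<Delta> a (\<lambda>p q. \<Delta> c (\<lambda>r s. \<Delta> (S d) (\<lambda>y z.
      G (S q * (r * y)) (S p * (s * z)))))))"
    by (rule sw_coassoc[symmetric]) (intro li)+
  also have "\<dots> = \<Delta> x (\<lambda>e d. \<Delta> (S d) (\<lambda>y z. \<Delta> e (\<lambda>a c. \<Delta> a (\<lambda>p q. \<Delta> c (\<lambda>r s.
      G (S q * (r * y)) (S p * (s * z)))))))"
    by (simp only: sw_swap[of _ _ "S _"])
  also have "\<dots> = \<Delta> x (\<lambda>e d. \<epsilon> e * \<Delta> (S d) G)"
    by (simp add: con sw_mult_left)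
  also have "\<dots> = \<Delta> (S x) G"
    by (rule sw_counit_left) (intro li)
  finally show ?thesis ..
qed

section \<open>The adjoint action\<close>

lemma adj_sw: "ad a b = \<Delta> a (\<lambda>p q. S p * b * q)"
  by (simp add: adj_def sw_def)

lemma lin_adj: "lin H f \<Longrightarrow> f (ad a b) = \<Delta> a (\<lambda>p q. f (S p * b * q))"
  by (simp add: adj_sw lin_sw)

lemma elin_adj_left: "elin H g \<Longrightarrow> elin H (\<lambda>x. ad (g x) b)"
  by (rule elinI) (subst lin_adj, assumption, intro lin_intros, auto intro!: lin_intros intro: lin_comp)

lemma elin_adj_right: "elin H g \<Longrightarrow> elin H (\<lambda>x. ad a (g x))"
  by (rule elinI) (subst lin_adj, assumption, intro lin_intros, auto intro!: lin_intros intro: lin_comp)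

text \<open>The antipode reverses products, so the adjoint action is a right action. Two successive
  braidings past \<open>x\<close> and \<open>y\<close> will thus merge into the single
  \<open>ad (x 5 * y 4)\<close> of \<theta>.\<close>

lemma adj_mult: "ad (x * y) b = ad y (ad x b)"
proof (rule lin_separates)
  fix f assume f: "lin H f"
  note li = lin_intros lin_comp[OF f]
  have "f (ad (x * y) b) = \<Delta> x (\<lambda>p q. \<Delta> y (\<lambda>r s. f (S (p * r) * b * (q * s))))"
    unfolding lin_adj[OF f] by (rule sw_mult) (intro li)+
  also have "\<dots> = \<Delta> y (\<lambda>r s. \<Delta> x (\<lambda>p q. f (S r * (S p * b * q) * s)))"
    by (subst sw_swap) (simp add: antipode_mult mult.assoc)
  also have "\<dots> = \<Delta> y (\<lambda>r s. f (S r * ad x b * s))"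
    by (rule sw_cong, rule lin_adj[where f = "\<lambda>u. f (_ * u * _)", symmetric]) (intro li)
  also have "\<dots> = f (ad y (ad x b))"
    by (rule lin_adj[OF f, symmetric])
  finally show "f (ad (x * y) b) = f (ad y (ad x b))" .
qed

text \<open>This makes braidings respect normalization, as \<open>counit_adj\<close> makes them
  respect the counit.\<close>

lemma adj_one_right: "ad a 1 = smult H (\<epsilon> a) 1"
  by (rule lin_separates) (simp add: lin_adj sw_antipode_left lin_smult)

lemma counit_adj: "\<epsilon> (ad a b) = \<epsilon> a * \<epsilon> b"
proof -
  have "\<epsilon> (ad a b) = \<Delta> a (\<lambda>p q. \<epsilon> (S p * q) * \<epsilon> b)"
    by (simp add: lin_adj lin_counit counit_mult mult_ac)
  then show ?thesis
    by (simp add: sw_mult_right sw_antipode_left[OF lin_counit] counit_one)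
qed

end

context fd_cocomm_hopf_algebra
begin

lemma sw_exchange:
  assumes "\<And>q r s. lin H (\<lambda>p. L p q r s)" "\<And>p r s. lin H (\<lambda>q. L p q r s)"
    "\<And>p q s. lin H (\<lambda>r. L p q r s)" "\<And>p q r. lin H (\<lambda>s. L p q r s)"
  shows "\<Delta> e (\<lambda>a c. \<Delta> a (\<lambda>p q. \<Delta> c (\<lambda>r s. L p q r s))) =
         \<Delta> e (\<lambda>a c. \<Delta> a (\<lambda>p q. \<Delta> c (\<lambda>r s. L p r q s)))"
proof -
  have "\<Delta> e (\<lambda>a c. \<Delta> a (\<lambda>p q. \<Delta> c (\<lambda>r s. L p q r s))) =
         \<Delta> e (\<lambda>p t. \<Delta> t (\<lambda>m s. \<Delta> m (\<lambda>q r. L p q r s)))"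
    by (rule sw_middle) (intro assms)+
  also have "\<dots> = \<Delta> e (\<lambda>p t. \<Delta> t (\<lambda>m s. \<Delta> m (\<lambda>q r. L p r q s)))"
    by (rule sw_cong, rule sw_cong, rule sw_cocomm) (intro assms)+
  also have "\<dots> = \<Delta> e (\<lambda>a c. \<Delta> a (\<lambda>p q. \<Delta> c (\<lambda>r s. L p r q s)))"
    by (rule sw_middle[symmetric]) (intro assms)+
  finally show ?thesis .
qed

text \<open>The antipode reverses the coproduct, so splitting \<open>S p * a * q\<close> pairs the
  legs of \<open>p\<close> with the wrong legs of \<open>q\<close>. Cocommutativity in
  \<open>p\<close> repairs this, and \<open>sw_exchange\<close> regroups the four legs of
  \<open>b\<close> into two adjoint actions.\<close>

lemma sw_adj:
  assumes G: "\<And>b. lin H (\<lambda>a. G a b)" "\<And>a. lin H (\<lambda>b. G a b)"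
  shows "\<Delta> (ad b a) G = \<Delta> b (\<lambda>u v. \<Delta> a (\<lambda>c d. G (ad u c) (ad v d)))"
proof -
  note li = lin_intros lin_comp[OF G(1)] lin_comp[OF G(2)]
  have *: "\<Delta> (S p * a * q) G =
      \<Delta> p (\<lambda>x y. \<Delta> q (\<lambda>r s. \<Delta> a (\<lambda>c d. G (S x * c * r) (S y * d * s))))" for p q
  proof -
    have "\<Delta> (S p * a * q) G = \<Delta> (S p * a) (\<lambda>m n. \<Delta> q (\<lambda>r s. G (m * r) (n * s)))"
      by (rule sw_mult) (intro li)+
    also have "\<dots> = \<Delta> (S p) (\<lambda>x y. \<Delta> a (\<lambda>c d. \<Delta> q (\<lambda>r s. G (x * c * r) (y * d * s))))"
      by (rule sw_mult) (intro li)+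
    also have "\<dots> = \<Delta> p (\<lambda>x y. \<Delta> a (\<lambda>c d. \<Delta> q (\<lambda>r s. G (S y * c * r) (S x * d * s))))"
      by (rule sw_antipode) (intro li)+
    also have "\<dots> = \<Delta> p (\<lambda>x y. \<Delta> a (\<lambda>c d. \<Delta> q (\<lambda>r s. G (S x * c * r) (S y * d * s))))"
      by (rule sw_cocomm) (intro li)+
    also have "\<dots> = \<Delta> p (\<lambda>x y. \<Delta> q (\<lambda>r s. \<Delta> a (\<lambda>c d. G (S x * c * r) (S y * d * s))))"
      by (subst sw_swap) (rule refl)
    finally show ?thesis .
  qed
  have **: "G (ad u c) (ad v d) = \<Delta> u (\<lambda>x y. \<Delta> v (\<lambda>r s. G (S x * c * y) (S r * d * s)))" for u v c d
    unfolding lin_adj[OF G(1)] by (intro arg_cong[of _ _ "\<Delta> _"] ext lin_adj[OF G(2)])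
  have "\<Delta> (ad b a) G = \<Delta> b (\<lambda>p q. \<Delta> (S p * a * q) G)"
    by (rule lin_adj[where f = "\<lambda>t. \<Delta> t G"]) (intro li)
  also have "\<dots> = \<Delta> b (\<lambda>u v. \<Delta> u (\<lambda>x y. \<Delta> v (\<lambda>r s. \<Delta> a (\<lambda>c d. G (S x * c * r) (S y * d * s)))))"
    by (simp add: *)
  also have "\<dots> = \<Delta> b (\<lambda>u v. \<Delta> u (\<lambda>x y. \<Delta> v (\<lambda>r s. \<Delta> a (\<lambda>c d. G (S x * c * y) (S r * d * s)))))"
    by (rule sw_exchange) (intro li)+
  also have "\<dots> = \<Delta> b (\<lambda>u v. \<Delta> a (\<lambda>c d. G (ad u c) (ad v d)))"
    unfolding ** by (simp only: sw_swap[of _ a])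
  finally show ?thesis .
qed

end

section \<open>Convolution of multilinear forms and precomposition with the braiding\<close>

context hopf_algebra
begin

section \<open>The convolution monoid of multilinear forms\<close>

lemma conv_Nil: "conv H f g [] = f [] * g []"
  by (simp add: conv_def)

lemma conv_Cons:
  "conv H f g (a # v) = \<Delta> a (\<lambda>b c. conv H (\<lambda>v. f (b # v)) (\<lambda>v. g (c # v)) v)"
  by (simp add: conv_def sw_def sum_list_concat_map comp_def case_prod_unfold)

lemma conv_sw_left: "conv H (\<lambda>v. \<Delta> a (\<lambda>b c. F b c v)) g v = \<Delta> a (\<lambda>b c. conv H (F b c) g v)"
  by (simp add: conv_def case_prod_unfold sw_sum_list flip: sw_mult_right)

lemma conv_sw_right: "conv H g (\<lambda>v. \<Delta> a (\<lambda>b c. F b c v)) v = \<Delta> a (\<lambda>b c. conv H g (F b c) v)"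
  by (simp add: conv_def case_prod_unfold sw_sum_list flip: sw_mult_left)

lemma conv_mult_left: "conv H (\<lambda>v. r * f v) g v = r * conv H f g v"
  by (simp add: conv_def case_prod_unfold mult.assoc sum_list_const_mult)

lemma conv_mult_right: "conv H g (\<lambda>v. r * f v) v = r * conv H g f v"
  by (simp add: conv_def case_prod_unfold mult.left_commute sum_list_const_mult)

lemma lin_sum_list_fun: "(\<And>x. lin H (\<lambda>a. F a x)) \<Longrightarrow> lin H (\<lambda>a. \<Sum>x\<leftarrow>xs. F a x)"
  by (induction xs) (auto simp: lin_def algebra_simps)

lemma lin_conv_left: "(\<And>v. lin H (\<lambda>x. F x v)) \<Longrightarrow> lin H (\<lambda>x. conv H (F x) g v)"
  unfolding conv_def case_prod_unfold by (intro lin_sum_list_fun lin_mult_right)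

lemma lin_conv_right: "(\<And>v. lin H (\<lambda>x. F x v)) \<Longrightarrow> lin H (\<lambda>x. conv H g (F x) v)"
  unfolding conv_def case_prod_unfold by (intro lin_sum_list_fun lin_mult_left)

lemmas lin_intros' = lin_intros lin_conv_left lin_conv_right
  elin_adj_left elin_adj_right

lemma splits_length:
  "p \<in> set (splits H v) \<Longrightarrow> length (fst p) = length v \<and> length (snd p) = length v"
  by (induction v arbitrary: p) auto

lemma conv_cong:
  assumes "\<And>u. length u = length v \<Longrightarrow> f u = f' u" "\<And>u. length u = length v \<Longrightarrow> g u = g' u"
  shows "conv H f g v = conv H f' g' v"
  unfolding conv_def case_prod_unfold
  by (intro arg_cong[of _ _ sum_list] map_cong) (auto dest: splits_length simp: assms)

lemma conv_forms: "f \<in> forms H n \<Longrightarrow> g \<in> forms H n \<Longrightarrow> conv H f g \<in> forms H n"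
proof (induction n arbitrary: f g)
  case 0
  have "conv H f g (a # v) = 0" for a v
    using 0 by (subst conv_Cons) (simp add: forms_0 conv_def case_prod_unfold)
  then show ?case by (auto simp: forms_0 neq_Nil_conv)
next
  case (Suc n)
  have "conv H f g [] = 0"
    using Suc.prems by (simp add: conv_Nil forms_Suc)
  moreover have "(\<lambda>v. conv H f g (a # v)) \<in> forms H n" for a
    unfolding conv_Cons by (intro forms_sw Suc.IH Suc.prems[THEN forms_Cons])
  moreover have "lin H (\<lambda>a. conv H f g (a # v))" for v
    unfolding conv_Cons by (intro lin_intros' Suc.prems[THEN lin_form_1])
  ultimately show ?case by (simp add: forms_Suc)
qed

lemma forms_0_Cons: "f \<in> forms H 0 \<Longrightarrow> f (a # v) = 0"
  by (simp add: forms_0)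

lemma counits_Cons: "counits H (Suc n) (a # v) = \<epsilon> a * counits H n v"
  by (simp add: counits_def)

lemma counits_Cons_fun: "(\<lambda>v. counits H (Suc n) (a # v)) = (\<lambda>v. \<epsilon> a * counits H n v)"
  by (simp add: counits_Cons)

lemma forms_mult: "f \<in> forms H n \<Longrightarrow> (\<lambda>v. r * f v) \<in> forms H n"
  by (simp add: forms_def mult_forms_UNIV algebra_simps)

lemma counits_forms: "counits H n \<in> forms H n"
proof (induction n)
  case 0
  show ?case by (auto simp: forms_0 counits_def)
next
  case (Suc n)
  then show ?case
    unfolding forms_Suc counits_Cons
    by (auto intro!: forms_mult lin_intros) (simp add: counits_def)
qed

lemma conv_assoc:
  assumes "f \<in> forms H n" "g \<in> forms H n" "h \<in> forms H n"
  shows "conv H (conv H f g) h v = conv H f (conv H g h) v"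
  using assms
proof (induction v arbitrary: n f g h)
  case Nil
  then show ?case by (simp add: conv_Nil mult.assoc)
next
  case (Cons a v)
  show ?case
  proof (cases n)
    case 0
    \<comment> \<open>List and arity vary separately in the induction. Here the list is longer than
      the arity, and both sides take the default value 0.\<close>
    with Cons.prems show ?thesis by (simp add: forms_0_Cons conv_forms)
  next
    case (Suc m)
    note F = Cons.prems[unfolded Suc]
    have IH: "conv H (conv H (\<lambda>v. f (p # v)) (\<lambda>v. g (q # v))) (\<lambda>v. h (r # v)) v =
              conv H (\<lambda>v. f (p # v)) (conv H (\<lambda>v. g (q # v)) (\<lambda>v. h (r # v))) v" for p q r
      by (rule Cons.IH[OF F[THEN forms_Cons]])
    have "conv H (conv H f g) h (a # v) = \<Delta> a (\<lambda>b c. \<Delta> b (\<lambda>p q.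
        conv H (conv H (\<lambda>v. f (p # v)) (\<lambda>v. g (q # v))) (\<lambda>v. h (c # v)) v))"
      by (simp add: conv_Cons conv_sw_left)
    also have "\<dots> = \<Delta> a (\<lambda>b c. \<Delta> c (\<lambda>q r.
        conv H (conv H (\<lambda>v. f (b # v)) (\<lambda>v. g (q # v))) (\<lambda>v. h (r # v)) v))"
      by (rule sw_coassoc) (intro lin_intros' F[THEN lin_form_1])+
    also have "\<dots> = conv H f (conv H g h) (a # v)"
      by (simp add: conv_Cons conv_sw_right IH)
    finally show ?thesis .
  qed
qed

lemma conv_counits_left: "f \<in> forms H n \<Longrightarrow> conv H (counits H n) f v = f v"
proof (induction v arbitrary: n f)
  case Nil
  then show ?case by (cases n) (auto simp: conv_Nil counits_def forms_Suc)
next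
  case (Cons a v)
  show ?case
  proof (cases n)
    case 0
    with Cons.prems show ?thesis by (simp add: forms_0_Cons conv_forms counits_forms)
  next
    case (Suc m)
    note F = Cons.prems[unfolded Suc]
    have "conv H (counits H m) (\<lambda>v. f (c # v)) v = f (c # v)" for c
      by (rule Cons.IH[of "\<lambda>v. f (_ # v)"]) (rule forms_Cons[OF F])
    then have "conv H (counits H n) f (a # v) = \<Delta> a (\<lambda>b c. \<epsilon> b * f (c # v))"
      by (simp add: Suc conv_Cons counits_Cons_fun conv_mult_left)
    also have "\<dots> = f (a # v)"
      by (rule sw_counit_left) (intro lin_intros' F[THEN lin_form_1])
    finally show ?thesis .
  qed
qed

lemma conv_counits_right: "f \<in> forms H n \<Longrightarrow> conv H f (counits H n) v = f v"
proof (induction v arbitrary: n f)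
  case Nil
  then show ?case by (cases n) (auto simp: conv_Nil counits_def forms_Suc)
next
  case (Cons a v)
  show ?case
  proof (cases n)
    case 0
    with Cons.prems show ?thesis by (simp add: forms_0_Cons conv_forms counits_forms)
  next
    case (Suc m)
    note F = Cons.prems[unfolded Suc]
    have "conv H (\<lambda>v. f (c # v)) (counits H m) v = f (c # v)" for c
      by (rule Cons.IH[of "\<lambda>v. f (_ # v)"]) (rule forms_Cons[OF F])
    then have "conv H f (counits H n) (a # v) = \<Delta> a (\<lambda>b c. \<epsilon> c * f (b # v))"
      by (simp add: Suc conv_Cons counits_Cons_fun conv_mult_right)
    also have "\<dots> = f (a # v)"
      by (rule sw_counit_right) (intro lin_intros' F[THEN lin_form_1])
    finally show ?thesis .
  qed
qed

text \<open>Normalization is agreement with the counit. The relation between two arbitrary forms is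
  kept because it is compatible with convolution, which is what the inverse of a normalized form
  requires.\<close>

definition agree_on_unit :: "nat \<Rightarrow> ('a list \<Rightarrow> 'k) \<Rightarrow> ('a list \<Rightarrow> 'k) \<Rightarrow> bool" where
  "agree_on_unit n f g \<longleftrightarrow> (\<forall>v. length v = n \<and> 1 \<in> set v \<longrightarrow> f v = g v)"

lemma agree_on_unit_Cons:
  "agree_on_unit (Suc n) f g \<Longrightarrow> agree_on_unit n (\<lambda>v. f (a # v)) (\<lambda>v. g (a # v))"
  by (auto simp: agree_on_unit_def)

text \<open>The coproduct of 1 is 1 \<otimes> 1, so an argument 1 reaches both factors as 1. When it
  is not the first argument, it stays in the tail and induction applies.\<close>

lemma agree_on_unit_conv:
  assumes "f \<in> forms H n" "g \<in> forms H n" "f' \<in> forms H n" "g' \<in> forms H n"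
    and "agree_on_unit n f f'" "agree_on_unit n g g'"
  shows "agree_on_unit n (conv H f g) (conv H f' g')"
  using assms
proof (induction n arbitrary: f g f' g')
  case 0
  then show ?case by (simp add: agree_on_unit_def)
next
  case (Suc n)
  note F = Suc.prems
  show ?case
    unfolding agree_on_unit_def
  proof (intro allI impI)
    fix v :: "'a list" assume v: "length v = Suc n \<and> 1 \<in> set v"
    then obtain a u where au: "v = a # u" "length u = n" by (cases v) auto
    show "conv H f g v = conv H f' g' v"
    proof (cases "1 \<in> set u")
      case True
      have "agree_on_unit n (conv H (\<lambda>v. f (b # v)) (\<lambda>v. g (c # v)))
              (conv H (\<lambda>v. f' (b # v)) (\<lambda>v. g' (c # v)))" for b c
        by (intro Suc.IH F(1-4)[THEN forms_Cons] F(5,6)[THEN agree_on_unit_Cons])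
      then show ?thesis
        using True au by (simp add: conv_Cons agree_on_unit_def)
    next
      case False
      with v au have a: "a = 1" by simp
      have "conv H f g (1 # u) = conv H (\<lambda>v. f (1 # v)) (\<lambda>v. g (1 # v)) u"
        unfolding conv_Cons by (rule sw_one) (intro lin_intros' F(1-4)[THEN lin_form_1])+
      also have "\<dots> = conv H (\<lambda>v. f' (1 # v)) (\<lambda>v. g' (1 # v)) u"
        using F(5,6) au by (intro conv_cong) (auto simp: agree_on_unit_def)
      also have "\<dots> = conv H f' g' (1 # u)"
        unfolding conv_Cons by (rule sw_one[symmetric]) (intro lin_intros' F(1-4)[THEN lin_form_1])+
      finally show ?thesis by (simp add: au a)
    qed
  qed
qed

text \<open>Precomposition of a form with the endomorphism \<open>\<sigma>\<^sub>i\<close>.\<close>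

definition twist :: "nat \<Rightarrow> ('a list \<Rightarrow> 'k) \<Rightarrow> 'a list \<Rightarrow> 'k" where
  "twist i f = (\<lambda>v. \<Delta> (v ! i) (\<lambda>b c. f (v[i - 1 := b, i := ad c (v ! (i - 1))])))"

text \<open>Positions count from 1, so the braidings that leave the first factor alone have index at
  least 2 and shift down once that factor is fixed.\<close>

lemma twist_Suc: "twist (Suc (Suc i)) f (a # v) = twist (Suc i) (\<lambda>v. f (a # v)) v"
  by (simp add: twist_def)

lemma twist_1: "twist (Suc 0) f (a # b # v) = \<Delta> b (\<lambda>p q. f (p # ad q a # v))"
  by (simp add: twist_def)

lemma twist_off_length: "f \<in> forms H n \<Longrightarrow> length v \<noteq> n \<Longrightarrow> twist i f v = 0"
  by (simp add: twist_def forms_off_length)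

lemma twist_forms:
  assumes "f \<in> forms H n" "0 < i" "i < n"
  shows "twist i f \<in> forms H n"
  using assms
proof (induction n arbitrary: i f)
  case (Suc n)
  note f = Suc.prems(1)
  have off: "twist i f [] = 0"
    using Suc.prems by (simp add: twist_off_length)
  show ?case
  proof (cases "i = 1")
    case True
    with Suc.prems obtain m where n: "n = Suc m" by (cases n) auto
    note f' = f[unfolded n]
    have off1: "twist 1 f [a] = 0" for a
      using f' by (simp add: twist_off_length)
    have "(\<lambda>v. twist 1 f (a # b # v)) \<in> forms H m" for a b
      unfolding One_nat_def twist_1 by (intro forms_sw f'[THEN forms_Cons, THEN forms_Cons])
    moreover have "lin H (\<lambda>b. twist 1 f (a # b # v))" for a v
      unfolding One_nat_def twist_1 by (intro lin_intros' f'[THEN lin_form_1] f'[THEN lin_form_2])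
    moreover have "lin H (\<lambda>a. twist 1 f (a # v))" for v
    proof (cases v)
      case (Cons b u)
      then show ?thesis unfolding One_nat_def by (simp only: twist_1) (intro lin_intros' f'[THEN lin_form_1] f'[THEN lin_form_2])
    next
      case Nil
      then show ?thesis using off1 by (simp add: lin_def)
    qed
    ultimately show ?thesis
      using off off1 by (simp add: True n forms_Suc)
  next
    case False
    then obtain j where i: "i = Suc (Suc j)"
      using Suc.prems by (cases i; cases "i - 1") auto
    show ?thesis
      unfolding forms_Suc
    proof (intro conjI allI)
      show "twist i f [] = 0" by (rule off)
      show "(\<lambda>v. twist i f (a # v)) \<in> forms H n" for a
        unfolding i twist_Suc by (rule Suc.IH) (use Suc.prems i in \<open>auto intro: forms_Cons\<close>)
      show "lin H (\<lambda>a. twist i f (a # v))" for v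
        unfolding i twist_Suc unfolding twist_def by (intro lin_intros' f[THEN lin_form_1])
    qed
  qed
qed simp

lemma twist_cong:
  assumes "\<And>u. length u = length v \<Longrightarrow> f u = g u"
  shows "twist i f v = twist i g v"
  unfolding twist_def by (rule sw_cong) (simp add: assms)

text \<open>A 1 in the acting place splits into two copies of 1, one of which remains an argument. A
  1 in the place acted on becomes a multiple of 1 by \<open>adj_one_right\<close>. A 1 elsewhere is
  untouched.\<close>

lemma agree_on_unit_twist:
  assumes "f \<in> forms H n" "g \<in> forms H n" "agree_on_unit n f g" "0 < i" "i < n"
  shows "agree_on_unit n (twist i f) (twist i g)"
  using assms
proof (induction n arbitrary: i f g)
  case (Suc n)
  note F = Suc.prems(1,2)
  show ?case
    unfolding agree_on_unit_def
  proof (intro allI impI)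
    fix v :: "'a list" assume v: "length v = Suc n \<and> 1 \<in> set v"
    then obtain a u where au: "v = a # u" "length u = n" by (cases v) auto
    show "twist i f v = twist i g v"
    proof (cases "i = 1")
      case True
      with Suc.prems au obtain b t m where u: "u = b # t" "n = Suc m" "length t = m"
        by (cases u) auto
      note F' = F[unfolded u(2)]
      have e: "1 \<in> {x, y} \<union> set t \<Longrightarrow> f (x # y # t) = g (x # y # t)" for x y
        using Suc.prems(3) u by (auto simp: agree_on_unit_def)
      have lin1: "\<Delta> 1 (\<lambda>p q. h (p # ad q a # t)) = h (1 # ad 1 a # t)"
        if "h \<in> forms H (Suc (Suc m))" for h
        by (rule sw_one) (intro lin_intros' that[THEN lin_form_1] that[THEN lin_form_2])+
      have lin2: "h (p # ad q 1 # t) = \<epsilon> q * h (p # 1 # t)"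
        if "h \<in> forms H (Suc (Suc m))" for h p q
        using lin_smult[OF lin_form_2[OF that elin_id]] by (simp add: adj_one_right)
      consider "b = 1" | "a = 1" | "1 \<in> set t" using v au u by auto
      then show ?thesis
      proof cases
        case 1
        then show ?thesis
          using lin1[OF F'(1)] lin1[OF F'(2)] e by (simp add: True au u twist_1)
      next
        case 2
        then show ?thesis
          using e by (simp add: True au u twist_1 lin2 F')
      next
        case 3
        then show ?thesis
          using e by (simp add: True au u twist_1)
      qed
    next
      case False
      then obtain j where i: "i = Suc (Suc j)"
        using Suc.prems by (cases i; cases "i - 1") auto
      show ?thesis
      proof (cases "1 \<in> set u")
        case True
        have "agree_on_unit n (twist (Suc j) (\<lambda>v. f (a # v))) (twist (Suc j) (\<lambda>v. g (a # v)))"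
          by (intro Suc.IH F[THEN forms_Cons] agree_on_unit_Cons[OF Suc.prems(3)]) (use Suc.prems i in auto)
        then show ?thesis using True au by (simp add: i twist_Suc agree_on_unit_def)
      next
        case False
        with v au have "a = 1" by simp
        then show ?thesis
          using Suc.prems(3) au unfolding i au(1) twist_Suc
          by (intro twist_cong) (auto simp: agree_on_unit_def)
      qed
    qed
  qed
qed simp

lemma twist_counits:
  assumes "0 < i" "i < n"
  shows "twist i (counits H n) = counits H n"
proof (rule forms_eqI)
  show "twist i (counits H n) \<in> forms H n" "counits H n \<in> forms H n"
    using assms by (auto intro: twist_forms counits_forms)
  fix v :: "'a list" assume "length v = n"
  then show "twist i (counits H n) v = counits H n v"
    using assms
  proof (induction n arbitrary: i v)
    case (Suc n)
    then obtain a u where au: "v = a # u" "length u = n" by (cases v) auto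
    show ?case
    proof (cases "i = 1")
      case True
      with Suc.prems au obtain b t m where u: "u = b # t" "n = Suc m"
        by (cases u) auto
      have "twist 1 (counits H (Suc n)) v = \<Delta> b (\<lambda>p q. \<epsilon> p * (\<epsilon> q * (\<epsilon> a * counits H m t)))"
        by (simp add: u au twist_1 counits_Cons counit_adj mult.assoc)
      also have "\<dots> = \<epsilon> b * (\<epsilon> a * counits H m t)"
        by (rule sw_counit_left) (intro lin_intros)
      finally show ?thesis by (simp add: True u au counits_Cons mult_ac)
    next
      case False
      then obtain j where i: "i = Suc (Suc j)"
        using Suc.prems by (cases i; cases "i - 1") auto
      have "twist (Suc j) (counits H n) u = counits H n u"
        by (rule Suc.IH) (use Suc.prems i au in auto)
      then show ?thesis
        by (simp add: i au twist_Suc counits_Cons_fun counits_Cons)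
          (simp add: twist_def sw_mult_left)
    qed
  qed simp
qed

end

context fd_cocomm_hopf_algebra
begin

lemma conv_commute:
  assumes "f \<in> forms H n" "g \<in> forms H n"
  shows "conv H f g v = conv H g f v"
  using assms
proof (induction v arbitrary: n f g)
  case Nil
  then show ?case by (simp add: conv_Nil mult.commute)
next
  case (Cons a v)
  show ?case
  proof (cases n)
    case 0
    with Cons.prems show ?thesis by (simp add: forms_0_Cons conv_forms)
  next
    case (Suc m)
    note F = Cons.prems[unfolded Suc]
    have IH: "conv H (\<lambda>v. f (b # v)) (\<lambda>v. g (c # v)) v = conv H (\<lambda>v. g (c # v)) (\<lambda>v. f (b # v)) v" for b c
      by (rule Cons.IH[OF F[THEN forms_Cons]])
    show ?thesis
      unfolding conv_Cons IH by (rule sw_cocomm) (intro lin_intros' F[THEN lin_form_1])+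
  qed
qed

text \<open>Everything happens at \<open>i = 1\<close>: \<open>sw_adj\<close> distributes the
  coproduct over the adjoint action, and \<open>sw_exchange\<close> then gives each convolution
  factor one leg of \<open>b\<close> as an argument and one as the acting element. Other positions
  reduce to this by fixing the first argument.\<close>

lemma twist_conv:
  assumes "f \<in> forms H n" "g \<in> forms H n" "0 < i" "i < n"
  shows "twist i (conv H f g) = conv H (twist i f) (twist i g)"
proof (rule forms_eqI)
  show "twist i (conv H f g) \<in> forms H n" "conv H (twist i f) (twist i g) \<in> forms H n"
    using assms by (auto intro: twist_forms conv_forms)
  fix v :: "'b list" assume "length v = n"
  then show "twist i (conv H f g) v = conv H (twist i f) (twist i g) v"
    using assms
  proof (induction n arbitrary: i v f g)
    case (Suc n)
    then obtain a u where au: "v = a # u" "length u = n" by (cases v) auto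
    note F = Suc.prems(2,3)
    show ?case
    proof (cases "i = 1")
      case True
      with Suc.prems au obtain b t m where u: "u = b # t" "n = Suc m"
        by (cases u) auto
      note F' = F[unfolded u(2)]
      let ?X = "\<lambda>p c r d. conv H (\<lambda>v. f (p # c # v)) (\<lambda>v. g (r # d # v)) t"
      have "twist 1 (conv H f g) v =
          \<Delta> b (\<lambda>x y. \<Delta> x (\<lambda>p r. \<Delta> (ad y a) (\<lambda>c d. ?X p c r d)))"
        by (simp add: au u twist_1 conv_Cons)
      also have "\<dots> = \<Delta> b (\<lambda>x y. \<Delta> x (\<lambda>p r. \<Delta> y (\<lambda>q s. \<Delta> a (\<lambda>c d. ?X p (ad q c) r (ad s d)))))"
        by (rule sw_cong, rule sw_cong, rule sw_adj) (intro lin_intros' F'[THEN lin_form_1] F'[THEN lin_form_2])+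
      also have "\<dots> = \<Delta> b (\<lambda>x y. \<Delta> x (\<lambda>p q. \<Delta> y (\<lambda>r s. \<Delta> a (\<lambda>c d. ?X p (ad q c) r (ad s d)))))"
        by (rule sw_exchange) (intro lin_intros' F'[THEN lin_form_1] F'[THEN lin_form_2])+
      also have "\<dots> = \<Delta> a (\<lambda>c d. \<Delta> b (\<lambda>x y. \<Delta> x (\<lambda>p q. \<Delta> y (\<lambda>r s. ?X p (ad q c) r (ad s d)))))"
        by (simp only: sw_swap[of _ a])
      also have "\<dots> = conv H (twist 1 f) (twist 1 g) v"
        by (simp add: au u conv_Cons twist_1 conv_sw_left conv_sw_right)
      finally show ?thesis by (simp add: True)
    next
      case False
      then obtain j where i: "i = Suc (Suc j)"
        using Suc.prems by (cases i; cases "i - 1") auto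
      have IH: "twist (Suc j) (conv H (\<lambda>v. f (b # v)) (\<lambda>v. g (c # v))) u =
            conv H (twist (Suc j) (\<lambda>v. f (b # v))) (twist (Suc j) (\<lambda>v. g (c # v))) u" for b c
        by (rule Suc.IH) (use Suc.prems i au in \<open>auto intro: forms_Cons\<close>)
      have "twist (Suc j) (\<lambda>v. conv H f g (a # v)) u =
          \<Delta> a (\<lambda>b c. twist (Suc j) (conv H (\<lambda>v. f (b # v)) (\<lambda>v. g (c # v))) u)"
        unfolding twist_def conv_Cons by (rule sw_swap)
      also have "\<dots> = conv H (twist i f) (twist i g) (a # u)"
        unfolding IH i conv_Cons twist_Suc ..
      finally show ?thesis
        by (simp add: i au twist_Suc)
    qed
  qed simp
qed

end

section \<open>Evaluation of braid words\<close>

lemma zero_tensor: "0 \<in> tensors M P"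
  unfolding tensors_def by (auto intro!: exI[of _ "[]"])

lemma pure_tensor_in_tensors: "p \<in> P \<Longrightarrow> pure_tensor M p \<in> tensors M P"
  unfolding tensors_def by (auto intro!: exI[of _ "[p]"])

lemma tensors_add:
  assumes "s \<in> tensors M P" "t \<in> tensors M P"
  shows "s + t \<in> tensors M P"
proof -
  from assms obtain ps qs where "set ps \<subseteq> P" "s = (\<Sum>p\<leftarrow>ps. pure_tensor M p)"
      "set qs \<subseteq> P" "t = (\<Sum>p\<leftarrow>qs. pure_tensor M p)"
    by (auto simp: tensors_def)
  then have "set (ps @ qs) \<subseteq> P \<and> s + t = (\<Sum>p\<leftarrow>ps @ qs. pure_tensor M p)" by simp
  then show ?thesis unfolding tensors_def by blast
qed

lemma tensors_sum_list:
  "(\<And>x. x \<in> set xs \<Longrightarrow> F x \<in> tensors M P) \<Longrightarrow> (\<Sum>x\<leftarrow>xs. F x) \<in> tensors M P"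
  by (induction xs) (auto intro: zero_tensor tensors_add)

text \<open>\<open>arg_min\<close> selects some shortest word; the selection is determined once no
  other word is equally short or shorter.\<close>

lemma arg_min_length_unique:
  assumes "P xs" "\<And>ys. P ys \<Longrightarrow> length ys \<le> length xs \<Longrightarrow> ys = xs"
  shows "arg_min length P = (xs :: 'b list)"
  by (rule assms(2)) (use assms(1) in \<open>auto intro: arg_min_natI arg_min_nat_le\<close>)

lemma word_of_transposition:
  assumes "1 \<le> i" "i < n"
  shows "arg_min length (is_word n (Transposition.transpose i (Suc i))) = [i]"
proof (rule arg_min_length_unique)
  show "is_word n (Transposition.transpose i (Suc i)) [i]"
    using assms by (simp add: is_word_def)
  fix js assume js: "is_word n (Transposition.transpose i (Suc i)) js" "length js \<le> length [i]"
  consider "js = []" | j where "js = [j]"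
    using js(2) by (cases js) auto
  then show "js = [i]"
  proof cases
    case 1
    then have "Transposition.transpose i (Suc i) i = id i" using js(1) by (simp add: is_word_def)
    then show ?thesis by simp
  next
    case 2
    then have e: "Transposition.transpose i (Suc i) = Transposition.transpose j (Suc j)"
      using js(1) by (simp add: is_word_def)
    have "j = i"
      using fun_cong[OF e, of i] fun_cong[OF e, of "Suc i"]
      by (simp add: Transposition.transpose_def split: if_splits)
    then show ?thesis by (simp add: 2)
  qed
qed

lemma word_of_id: "arg_min length (is_word n id) = []"
  by (rule arg_min_length_unique) (auto simp: is_word_def)

text \<open>A 3-cycle moves all three letters, which excludes the empty word, one transposition and
  a repeated transposition. The two words left give the two 3-cycles, told apart by the image of
  1.\<close>

lemma word_of_3_cycle:
  assumes "(i, j) \<in> {(1, 2), (2, 1)}"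
  shows "arg_min length (is_word 3 (Transposition.transpose i (Suc i) \<circ> Transposition.transpose j (Suc j))) = [i, j]"
    (is "arg_min length (is_word 3 ?u) = _")
proof (rule arg_min_length_unique)
  show "is_word 3 ?u [i, j]"
    using assms by (auto simp: is_word_def)
  fix ks assume ks: "is_word 3 ?u ks" "length ks \<le> length [i, j]"
  have v: "?u 1 \<noteq> 1" "?u 2 \<noteq> 2" "?u 3 \<noteq> 3" "i = 1 \<Longrightarrow> ?u 1 = 2" "i = 2 \<Longrightarrow> ?u 1 = 3"
    using assms by (auto simp: Transposition.transpose_def)
  have ks12: "set ks \<subseteq> {1, 2}" and u: "?u = foldr (\<circ>) (map (\<lambda>i. Transposition.transpose i (i + 1)) ks) id"
    using ks(1) by (auto simp: is_word_def)
  consider "ks = []" | k where "ks = [k]" | k l where "ks = [k, l]"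
    using ks(2) by (cases ks; cases "tl ks") auto
  then show "ks = [i, j]"
  proof cases
    case 1
    then show ?thesis using v(1) unfolding u by simp
  next
    case 2
    then have "k = 1 \<or> k = 2" using ks12 by auto
    then show ?thesis using v(1-3) unfolding u 2 by (auto simp: Transposition.transpose_def)
  next
    case 3
    then have "(k = 1 \<or> k = 2) \<and> (l = 1 \<or> l = 2)" using ks12 by auto
    then show ?thesis using v assms unfolding u 3 by (auto simp: Transposition.transpose_def)
  qed
qed

context hopf_algebra
begin

lemma tens_eval: "f \<in> forms H n \<Longrightarrow> tens H n v f = f v"
  by (simp add: tens_def pure_tensor_def)

lemma tens_in_tensors: "length v = n \<Longrightarrow> tens H n v \<in> tensors (forms H n) (nlists n UNIV)"
  unfolding tens_def by (rule pure_tensor_in_tensors) (simp add: in_nlists_UNIV)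

lemma braid_in_tensors:
  assumes "t \<in> tensors (forms H n) (nlists n UNIV)"
  shows "braid H n i t \<in> tensors (forms H n) (nlists n UNIV)"
  unfolding braid_def lin_ext_def
  using terms_tensor(1)[OF assms]
  by (intro tensors_sum_list tens_in_tensors) (auto simp: in_nlists_UNIV)

text \<open>\<open>twist i\<close> is the transpose of \<open>braid H n i\<close>. Multilinearity of
  \<open>twist i f\<close> lets \<open>sum_terms\<close> remove the presentation chosen in
  \<open>lin_ext\<close>.\<close>

lemma braid_eval:
  assumes "t \<in> tensors (forms H n) (nlists n UNIV)" "f \<in> forms H n" "0 < i" "i < n"
  shows "braid H n i t f = t (twist i f)"
proof -
  have "braid H n i t f = (\<Sum>v\<leftarrow>terms (forms H n) (nlists n UNIV) t. twist i f v)"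
    using assms(2) by (simp add: braid_def lin_ext_def sum_list_apply tens_eval twist_def sw_def)
  also have "\<dots> = t (twist i f)"
    by (rule sum_terms[OF assms(1) twist_forms[OF assms(2-4)]])
  finally show ?thesis .
qed

text \<open>Transposition reverses composition: the leftmost braiding reaches the form first, which
  is the order of \<open>fold\<close>.\<close>

lemma braid_word_eval:
  assumes "t \<in> tensors (forms H n) (nlists n UNIV)" "f \<in> forms H n" "set is \<subseteq> {1..<n}"
  shows "foldr (\<circ>) (map (braid H n) is) id t f = t (fold twist is f)"
  using assms(2,3)
proof (induction "is" arbitrary: f)
  case (Cons i "is")
  have "foldr (\<circ>) (map (braid H n) js) id t \<in> tensors (forms H n) (nlists n UNIV)" for js
    by (induction js) (auto intro: braid_in_tensors assms(1))
  moreover have i: "0 < i" "i < n" "set is \<subseteq> {1..<n}"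
    using Cons.prems by auto
  ultimately have "foldr (\<circ>) (map (braid H n) (i # is)) id t f =
      foldr (\<circ>) (map (braid H n) is) id t (twist i f)"
    using Cons.prems(1) by (simp only: list.map foldr.simps comp_apply braid_eval)
  also have "\<dots> = t (fold twist is (twist i f))"
    by (intro Cons.IH twist_forms Cons.prems i)
  finally show ?case by (simp only: fold_simps)
qed simp

lemma fold_twist_forms: "f \<in> forms H n \<Longrightarrow> set is \<subseteq> {1..<n} \<Longrightarrow> fold twist is f \<in> forms H n"
  by (induction "is" arbitrary: f) (simp_all add: twist_forms Suc_le_eq)

lemma precomp_braid_word:
  assumes "f \<in> forms H n" "set is \<subseteq> {1..<n}"
  shows "precomp H n f (foldr (\<circ>) (map (braid H n) is) id) = fold twist is f"
proof
  fix v
  show "precomp H n f (foldr (\<circ>) (map (braid H n) is) id) v = fold twist is f v"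
    using assms fold_twist_forms[OF assms]
    by (auto simp: precomp_def braid_word_eval tens_in_tensors tens_eval forms_off_length)
qed

section \<open>Convolution groups and normalized forms\<close>

abbreviation "conv_monoid n \<equiv> \<lparr>carrier = forms H n, monoid.mult = conv H, one = counits H n\<rparr>"

lemma conv_monoid: "monoid (conv_monoid n)"
  by (intro monoidI)
    (auto intro: conv_forms counits_forms conv_assoc conv_counits_left conv_counits_right)

lemma Reg_simps:
  "carrier (Reg H n) = Units (conv_monoid n)" "f \<otimes>\<^bsub>Reg H n\<^esub> g = conv H f g" "\<one>\<^bsub>Reg H n\<^esub> = counits H n"
  by (simp_all add: Reg_def units_of_carrier units_of_mult units_of_one)

lemma Reg_carrierI:
  "f \<in> forms H n \<Longrightarrow> g \<in> forms H n \<Longrightarrow> conv H f g = counits H n \<Longrightarrow> conv H g f = counits H n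
    \<Longrightarrow> f \<in> carrier (Reg H n)"
  unfolding Reg_simps Units_def by auto

lemma Reg_forms: "f \<in> carrier (Reg H n) \<Longrightarrow> f \<in> forms H n"
  unfolding Reg_simps Units_def by auto

lemma Reg_group: "group (Reg H n)"
  unfolding Reg_def by (rule monoid.units_group[OF conv_monoid])

lemma Reg_inv:
  assumes "f \<in> carrier (Reg H n)"
  shows "inv\<^bsub>Reg H n\<^esub> f \<in> carrier (Reg H n)"
    "conv H f (inv\<^bsub>Reg H n\<^esub> f) = counits H n" "conv H (inv\<^bsub>Reg H n\<^esub> f) f = counits H n"
  using group.inv_closed[OF Reg_group assms] group.r_inv[OF Reg_group assms] group.l_inv[OF Reg_group assms]
  by (simp_all only: Reg_simps(2,3))

lemma Reg_N_iff: "f \<in> Reg_N H n \<longleftrightarrow> f \<in> carrier (Reg H n) \<and> agree_on_unit n f (counits H n)"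
  by (auto simp: Reg_N_def agree_on_unit_def counits_def)

lemma Reg_N_conv:
  assumes "f \<in> Reg_N H n" "g \<in> Reg_N H n"
  shows "conv H f g \<in> Reg_N H n"
proof -
  have "agree_on_unit n (conv H f g) (conv H (counits H n) (counits H n))"
    using assms unfolding Reg_N_iff by (intro agree_on_unit_conv) (auto intro: Reg_forms counits_forms)
  moreover have "conv H (counits H n) (counits H n) = counits H n"
    by (intro ext conv_counits_left counits_forms)
  moreover have "conv H f g \<in> carrier (Reg H n)"
    using assms monoid.m_closed[OF group.is_monoid[OF Reg_group], of f n g]
    unfolding Reg_N_iff by (simp only: Reg_simps(2))
  ultimately show ?thesis unfolding Reg_N_iff by simp
qed

text \<open>Where \<open>f\<close> agrees with the counit, its product with the inverse agrees with
  the product of the counit and the inverse. The former is the counit and the latter the inverse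
  itself.\<close>

lemma Reg_N_inv:
  assumes "f \<in> Reg_N H n"
  shows "inv\<^bsub>Reg H n\<^esub> f \<in> Reg_N H n"
proof -
  let ?g = "inv\<^bsub>Reg H n\<^esub> f"
  have f: "f \<in> carrier (Reg H n)" "agree_on_unit n f (counits H n)"
    using assms by (auto simp: Reg_N_iff)
  note g = Reg_inv[OF f(1)]
  have "agree_on_unit n (conv H f ?g) (conv H (counits H n) ?g)"
    by (rule agree_on_unit_conv)
      (use f g in \<open>auto intro: Reg_forms counits_forms simp: agree_on_unit_def\<close>)
  moreover have "conv H (counits H n) ?g = ?g"
    by (intro ext conv_counits_left Reg_forms g)
  ultimately have "agree_on_unit n ?g (counits H n)"
    by (simp add: g agree_on_unit_def)
  with g(1) show ?thesis by (simp add: Reg_N_iff)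
qed

end

context fd_cocomm_hopf_algebra
begin

lemma Reg_comm_group: "comm_group (Reg H n)"
  by (rule group.group_comm_groupI[OF Reg_group]) (auto simp: Reg_simps(2) intro!: conv_commute dest: Reg_forms)

text \<open>As \<open>twist i\<close> preserves convolution and its unit, it carries the inverse of
  \<open>f\<close> to an inverse of \<open>twist i f\<close>.\<close>

lemma twist_Reg_N:
  assumes "f \<in> Reg_N H n" "0 < i" "i < n"
  shows "twist i f \<in> Reg_N H n"
proof -
  let ?g = "inv\<^bsub>Reg H n\<^esub> f"
  have f: "f \<in> carrier (Reg H n)" "agree_on_unit n f (counits H n)"
    using assms by (auto simp: Reg_N_iff)
  note g = Reg_inv[OF f(1)]
  note forms = Reg_forms[OF f(1)] Reg_forms[OF g(1)]
  have "twist i f \<in> carrier (Reg H n)"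
    by (rule Reg_carrierI[where g = "twist i ?g"])
      (use assms(2,3) forms g in \<open>simp_all add: twist_forms twist_counits flip: twist_conv[of _ n]\<close>)
  moreover have "agree_on_unit n (twist i f) (counits H n)"
    using agree_on_unit_twist[OF forms(1) counits_forms f(2) assms(2,3)] assms(2,3)
    by (simp add: twist_counits)
  ultimately show ?thesis by (simp add: Reg_N_iff)
qed

end

section \<open>Shuffles of three letters\<close>

abbreviation adjacent :: "nat \<Rightarrow> nat \<Rightarrow> nat" where
  "adjacent i \<equiv> Transposition.transpose i (Suc i)"

lemma permutes_3_eqI:
  fixes u v :: "nat \<Rightarrow> nat"
  assumes "u permutes {1..3}" "v permutes {1..3}" "u 1 = v 1" "u 2 = v 2" "u 3 = v 3"
  shows "u = v"
proof
  fix x :: nat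
  consider "x = 1" | "x = 2" | "x = 3" | "x \<notin> {1..3}" by force
  then show "u x = v x"
    using assms by cases (auto simp: permutes_not_in)
qed

lemma permutes_3_cases:
  fixes u :: "nat \<Rightarrow> nat"
  assumes "u permutes {1..3}"
  shows "(u 1, u 2, u 3) \<in> {(1, 2, 3), (1, 3, 2), (2, 1, 3), (2, 3, 1), (3, 1, 2), (3, 2, 1)}"
proof -
  have r: "1 \<le> u i \<and> u i \<le> 3" if "1 \<le> i \<and> i \<le> 3" for i
    using permutes_in_image[OF assms, of i] that by simp
  have d: "u i = u j \<longleftrightarrow> i = j" for i j
    using permutes_inj[OF assms] by (simp add: inj_eq)
  have "u 1 \<noteq> u 2" "u 1 \<noteq> u 3" "u 2 \<noteq> u 3" unfolding d by simp_all
  moreover have "(a, b, c) \<in> {(1, 2, 3), (1, 3, 2), (2, 1, 3), (2, 3, 1), (3, 1, 2), (3, 2, 1)}"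
    if "1 \<le> a \<and> a \<le> 3" "1 \<le> b \<and> b \<le> 3" "1 \<le> c \<and> c \<le> 3" "a \<noteq> b" "a \<noteq> c" "b \<noteq> c"
    for a b c :: nat
    using that by (simp only: insert_iff empty_iff prod.inject) presburger
  ultimately show ?thesis
    using r[of 1] r[of 2] r[of 3] by (simp only: le_refl one_le_numeral) simp
qed

lemma adjacent_permutes: "i \<in> {1, 2} \<Longrightarrow> adjacent i permutes {1..3}"
  by (auto intro: permutes_swap_id)

lemma shuffles_iff:
  "u \<in> shuffles 0 3 \<longleftrightarrow> u permutes {1..3} \<and> u 1 < u 2 \<and> u 2 < u 3"
  "u \<in> shuffles 1 3 \<longleftrightarrow> u permutes {1..3} \<and> u 2 < u 3"
  "u \<in> shuffles 2 3 \<longleftrightarrow> u permutes {1..3} \<and> u 1 < u 2"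
  "u \<in> shuffles 3 3 \<longleftrightarrow> u permutes {1..3} \<and> u 1 < u 2 \<and> u 2 < u 3"
proof -
  have "{1..3} = {1, 2, 3 :: nat}" "{1..2} = {1, 2 :: nat}" "{2..3} = {2, 3 :: nat}" by auto
  then have "strict_mono_on {1..3} u \<longleftrightarrow> u 1 < u 2 \<and> u 2 < u 3" "strict_mono_on {1..2} u \<longleftrightarrow> u 1 < u 2"
    "strict_mono_on {2..3} u \<longleftrightarrow> u 2 < u 3"
    by (auto simp: strict_mono_on_def simp del: One_nat_def)
  moreover have "strict_mono_on {a} u" "strict_mono_on {} u" for a
    by (auto simp: strict_mono_on_def)
  moreover have "0 + 1 = (1::nat)" "1 + 1 = (2::nat)" "2 + 1 = (3::nat)" "3 + 1 = (4::nat)" "{1..1} = {1::nat}"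
    "{1..0} = ({} :: nat set)" "{4..3} = ({} :: nat set)" "{3..3} = {3::nat}" by auto
  ultimately show "u \<in> shuffles 0 3 \<longleftrightarrow> u permutes {1..3} \<and> u 1 < u 2 \<and> u 2 < u 3"
    "u \<in> shuffles 1 3 \<longleftrightarrow> u permutes {1..3} \<and> u 2 < u 3"
    "u \<in> shuffles 2 3 \<longleftrightarrow> u permutes {1..3} \<and> u 1 < u 2"
    "u \<in> shuffles 3 3 \<longleftrightarrow> u permutes {1..3} \<and> u 1 < u 2 \<and> u 2 < u 3"
    by (simp_all only: shuffles_def mem_Collect_eq simp_thms)
qed

text \<open>A shuffle for \<open>p = 1\<close> is fixed by its value at 1, one for
  \<open>p = 2\<close> by its value at 3, hence three of each. The proof compares the six possible
  value tables with the candidates.\<close>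

lemma shuffles_3_eq:
  shows shuffles_0_3: "shuffles 0 3 = {id}"
    and shuffles_3_3: "shuffles 3 3 = {id}"
    and shuffles_1_3: "shuffles 1 3 = {id, adjacent 1, adjacent 2 \<circ> adjacent 1}"
    and shuffles_2_3: "shuffles 2 3 = {id, adjacent 2, adjacent 1 \<circ> adjacent 2}"
proof -
  have perm: "id permutes {1..3::nat}" "adjacent 1 permutes {1..3}" "adjacent 2 permutes {1..3}"
    "adjacent 2 \<circ> adjacent 1 permutes {1..3}" "adjacent 1 \<circ> adjacent 2 permutes {1..3}"
    by (rule permutes_id permutes_compose adjacent_permutes insertI1 insertI2)+
  have val: "adjacent 1 1 = 2" "adjacent 1 2 = 1" "adjacent 1 3 = 3"
    "adjacent 2 1 = 1" "adjacent 2 2 = 3" "adjacent 2 3 = 2"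
    by (simp_all add: Transposition.transpose_def)
  note eq = permutes_3_eqI[OF _ perm(1)] permutes_3_eqI[OF _ perm(2)] permutes_3_eqI[OF _ perm(3)]
    permutes_3_eqI[OF _ perm(4)] permutes_3_eqI[OF _ perm(5)]
  note eq' = eq[unfolded comp_apply id_apply val]
  have "u = id" if "u permutes {1..3}" "u 1 < u 2" "u 2 < u 3" for u :: "nat \<Rightarrow> nat"
    using permutes_3_cases[OF that(1)] that eq'(1)[of u] by auto
  then show "shuffles 0 3 = {id}" "shuffles 3 3 = {id}"
    using perm by (auto simp: shuffles_iff)
  have "u \<in> {id, adjacent 1, adjacent 2 \<circ> adjacent 1}" if "u permutes {1..3}" "u 2 < u 3" for u :: "nat \<Rightarrow> nat"
    using permutes_3_cases[OF that(1)] that eq'(1,2,4)[of u] by auto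
  moreover have "u permutes {1..3} \<and> u 2 < u 3" if "u \<in> {id, adjacent 1, adjacent 2 \<circ> adjacent 1}" for u
    using that by (elim insertE emptyE) (simp_all only: perm comp_apply id_apply val, simp_all)
  ultimately show "shuffles 1 3 = {id, adjacent 1, adjacent 2 \<circ> adjacent 1}"
    unfolding set_eq_iff shuffles_iff by blast
  have "u \<in> {id, adjacent 2, adjacent 1 \<circ> adjacent 2}" if "u permutes {1..3}" "u 1 < u 2" for u :: "nat \<Rightarrow> nat"
    using permutes_3_cases[OF that(1)] that eq'(1,3,5)[of u] by auto
  moreover have "u permutes {1..3} \<and> u 1 < u 2" if "u \<in> {id, adjacent 2, adjacent 1 \<circ> adjacent 2}" for u
    using that by (elim insertE emptyE) (simp_all only: perm comp_apply id_apply val, simp_all)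
  ultimately show "shuffles 2 3 = {id, adjacent 2, adjacent 1 \<circ> adjacent 2}"
    unfolding set_eq_iff shuffles_iff by blast
qed

lemma sign_adjacent: "sign (adjacent i) = - 1"
  by (simp add: sign_swap_id)

lemma sign_adjacent_comp: "sign (adjacent i \<circ> adjacent j) = 1"
  by (simp add: sign_compose permutation_swap_id sign_swap_id)

context hopf_algebra
begin

definition phi_factor :: "nat \<Rightarrow> ('a list \<Rightarrow> 'k) \<Rightarrow> (nat \<Rightarrow> nat) \<Rightarrow> 'a list \<Rightarrow> 'k" where
  "phi_factor n f u = precomp H n (f [^]\<^bsub>Reg H n\<^esub> sign u) (T_braid H n u)"

lemma phi_eq: "phi H p n f = finprod (Reg H n) (phi_factor n f) (shuffles p n)"
  by (simp add: phi_def phi_factor_def[abs_def])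

lemma T_braid_word:
  "arg_min length (is_word n u) = is \<Longrightarrow> T_braid H n u = foldr (\<circ>) (map (braid H n) is) id"
  by (simp add: T_braid_def)

section \<open>From forms on concatenated tuples to forms in two blocks\<close>

lemma conv_append:
  "conv H F G (a @ b) = (\<Sum>(a1, a2)\<leftarrow>splits H a. \<Sum>(b1, b2)\<leftarrow>splits H b. F (a1 @ b1) * G (a2 @ b2))"
proof (induction a arbitrary: F G)
  case Nil
  then show ?case by (simp add: conv_def)
next
  case (Cons x a)
  then show ?case
    by (simp add: conv_Cons sw_def sum_list_concat_map comp_def case_prod_unfold)
qed

text \<open>\<open>Lambda\<close> places its second block in front, so the two sides split the
  blocks in opposite orders and agree after interchanging the sums. Inverses in \<open>Reg\<close>
  therefore yield inverses in \<open>C_grp\<close>.\<close>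

lemma conv2_Lambda: "conv2 H (Lambda p q F) (Lambda p q G) = Lambda p q (conv H F G)"
proof (intro ext)
  fix b a
  show "conv2 H (Lambda p q F) (Lambda p q G) b a = Lambda p q (conv H F G) b a"
  proof (cases "length b = q \<and> length a = p")
    case True
    have "conv2 H (Lambda p q F) (Lambda p q G) b a =
        (\<Sum>(b1, b2)\<leftarrow>splits H b. \<Sum>(a1, a2)\<leftarrow>splits H a. F (a1 @ b1) * G (a2 @ b2))"
      unfolding conv2_def case_prod_unfold
      by (intro arg_cong[of _ _ sum_list] map_cong refl) (auto dest!: splits_length simp: Lambda_def True)
    also have "\<dots> = conv H F G (a @ b)"
      unfolding conv_append case_prod_unfold by (rule sum_list_swap)
    finally show ?thesis using True by (simp add: Lambda_def)
  next
    case False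
    \<comment> \<open>Splitting preserves lengths, so every term is a default value 0.\<close>
    have "Lambda p q F (fst s) (fst r) = 0" if "s \<in> set (splits H b)" "r \<in> set (splits H a)" for s r
      using that False by (auto dest!: splits_length simp: Lambda_def)
    then have "conv2 H (Lambda p q F) (Lambda p q G) b a =
        (\<Sum>s\<leftarrow>splits H b. \<Sum>r\<leftarrow>splits H a. 0)"
      unfolding conv2_def case_prod_unfold
      by (intro arg_cong[of _ _ sum_list] map_cong refl) auto
    then show ?thesis using False by (auto simp: Lambda_def)
  qed
qed

lemma Lambda_forms2:
  assumes "F \<in> forms H (p + q)"
  shows "Lambda p q F \<in> forms2 H q p"
proof -
  have upd: "F (v[i := x + y]) = F (v[i := x]) + F (v[i := y])" "F (v[i := smult H c x]) = c * F (v[i := x])"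
    if "length v = p + q" "i < p + q" for v i x y c
    using assms that unfolding forms_def mult_forms_UNIV by blast+
  have "Lambda p q F b \<in> forms H p" for b
    unfolding forms_def mult_forms_UNIV Lambda_def
    by (auto simp: upd simp flip: list_update_append1)
  moreover have "(\<lambda>b. Lambda p q F b a) \<in> forms H q" for a
  proof -
    have "a @ b[i := x] = (a @ b)[length a + i := x]" for b i x
      by (simp add: list_update_append)
    then show ?thesis
      unfolding forms_def mult_forms_UNIV Lambda_def by (auto simp: upd)
  qed
  ultimately show ?thesis by (simp add: forms2_def)
qed

lemma Lambda_counits: "Lambda p q (counits H (p + q)) = (\<lambda>b a. counits H q b * counits H p a)"
  by (intro ext) (auto simp: Lambda_def counits_def mult.commute)

lemma Lambda_C_N:
  assumes "F \<in> Reg_N H (p + q)"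
  shows "Lambda p q F \<in> C_N H q p"
proof -
  let ?G = "inv\<^bsub>Reg H (p + q)\<^esub> F"
  have F: "F \<in> carrier (Reg H (p + q))" using assms by (simp add: Reg_N_def)
  note G = Reg_inv[OF F]
  have "Lambda p q F \<in> forms2 H q p" "Lambda p q ?G \<in> forms2 H q p"
    using F G by (auto intro: Lambda_forms2 Reg_forms)
  moreover have "conv2 H (Lambda p q F) (Lambda p q ?G) = (\<lambda>b a. counits H q b * counits H p a)"
    "conv2 H (Lambda p q ?G) (Lambda p q F) = (\<lambda>b a. counits H q b * counits H p a)"
    by (simp_all add: conv2_Lambda G Lambda_counits)
  ultimately have "Lambda p q F \<in> carrier (C_grp H q p)"
    unfolding C_grp_def units_of_carrier Units_def by auto
  then show ?thesis
    using assms by (auto simp: C_N_def Reg_N_def Lambda_def mult.commute)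
qed

end

section \<open>The products over shuffles in degree 3\<close>

context fd_cocomm_hopf_algebra
begin

context
  fixes w
  assumes w: "w \<in> Reg_N H 3"
begin

private abbreviation "w' \<equiv> inv\<^bsub>Reg H 3\<^esub> w"

private lemma w': "w' \<in> Reg_N H 3"
  by (rule Reg_N_inv[OF w])

private lemma forms: "w \<in> forms H 3" "w' \<in> forms H 3"
  using w w' by (auto simp: Reg_N_def intro: Reg_forms)

private lemma pow: "w [^]\<^bsub>Reg H 3\<^esub> (1::int) = w" "w [^]\<^bsub>Reg H 3\<^esub> (- 1::int) = w'"
proof -
  interpret group "Reg H 3" by (rule Reg_group)
  have "w \<in> carrier (Reg H 3)" using w by (simp add: Reg_N_def)
  then show "w [^]\<^bsub>Reg H 3\<^esub> (1::int) = w" "w [^]\<^bsub>Reg H 3\<^esub> (- 1::int) = w'"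
    by (simp_all add: int_pow_neg int_pow_1 del: int_pow_neg_int)
qed

private abbreviation "factor \<equiv> phi_factor 3 w"

private lemma factor_id: "factor id = w"
  using precomp_braid_word[OF forms(1), of "[]"]
  by (simp add: phi_factor_def T_braid_word[OF word_of_id] sign_id pow)

private lemma factor_adjacent: "i \<in> {1, 2} \<Longrightarrow> factor (adjacent i) = twist i w'"
  using precomp_braid_word[OF forms(2), of "[i]"] T_braid_word[OF word_of_transposition[of i 3]]
  by (auto simp: phi_factor_def sign_adjacent pow)

private lemma factor_3_cycle:
  "(i, j) \<in> {(1, 2), (2, 1)} \<Longrightarrow> factor (adjacent i \<circ> adjacent j) = twist j (twist i w)"
  using precomp_braid_word[OF forms(1), of "[i, j]"] T_braid_word[OF word_of_3_cycle[of i j]]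
  by (auto simp: phi_factor_def sign_adjacent_comp pow)

lemma phi_trivial: "phi H 0 3 w = w" "phi H 3 3 w = w"
proof -
  interpret comm_group "Reg H 3" by (rule Reg_comm_group)
  have "w \<in> carrier (Reg H 3)" using w by (simp add: Reg_N_def)
  then show "phi H 0 3 w = w" "phi H 3 3 w = w"
    by (simp_all add: phi_eq shuffles_3_eq factor_id)
qed

text \<open>The cases \<open>p = 1\<close> and \<open>p = 2\<close> are mirror images under
  exchanging the two braidings, so one computation with \<open>(i, j)\<close> serves both.\<close>

lemma phi_product:
  assumes "(i, j) \<in> {(1, 2), (2, 1)}" "p \<in> {1, 2}"
    and "shuffles p 3 = {id, adjacent i, adjacent j \<circ> adjacent i}"
  shows "phi H p 3 w = conv H w (conv H (twist i w') (twist i (twist j w)))"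
    "phi H p 3 w \<in> Reg_N H 3"
proof -
  interpret comm_group "Reg H 3" by (rule Reg_comm_group)
  have ij: "i \<in> {1, 2}" "(j, i) \<in> {(1, 2), (2, 1)}" "0 < i" "i < 3" "0 < j" "j < 3"
    using assms(1) by auto
  \<comment> \<open>\<open>finprod_insert\<close> needs distinct shuffles. The sign separates the
    transposition from the other two, which are then separated by their values at 2.\<close>
  have ne: "id \<noteq> adjacent i" "adjacent i \<noteq> adjacent j \<circ> adjacent i"
    using sign_adjacent[of i] sign_adjacent_comp[of j i] sign_id by force+
  have "(adjacent j \<circ> adjacent i) 2 \<noteq> 2"
    using assms(1) by (auto simp: Transposition.transpose_def)
  then have ne': "id \<noteq> adjacent j \<circ> adjacent i"
    by (metis id_apply)
  have R: "w \<in> Reg_N H 3" "twist i w' \<in> Reg_N H 3" "twist i (twist j w) \<in> Reg_N H 3"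
    using w w' ij by (auto intro!: twist_Reg_N)
  then have C: "w \<in> carrier (Reg H 3)" "twist i w' \<in> carrier (Reg H 3)"
      "twist i (twist j w) \<in> carrier (Reg H 3)"
    by (auto simp: Reg_N_def)
  have f: "factor id = w" "factor (adjacent i) = twist i w'"
    "factor (adjacent j \<circ> adjacent i) = twist i (twist j w)"
    by (rule factor_id, rule factor_adjacent[OF ij(1)], rule factor_3_cycle[OF ij(2)])
  have "phi H p 3 w = factor id \<otimes>\<^bsub>Reg H 3\<^esub> finprod (Reg H 3) factor {adjacent i, adjacent j \<circ> adjacent i}"
    unfolding phi_eq assms(3) by (rule finprod_insert) (use ne ne' C f in auto)
  also have "finprod (Reg H 3) factor {adjacent i, adjacent j \<circ> adjacent i} =
      factor (adjacent i) \<otimes>\<^bsub>Reg H 3\<^esub> finprod (Reg H 3) factor {adjacent j \<circ> adjacent i}"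
    by (rule finprod_insert) (use ne C f in auto)
  also have "finprod (Reg H 3) factor {adjacent j \<circ> adjacent i} =
      factor (adjacent j \<circ> adjacent i) \<otimes>\<^bsub>Reg H 3\<^esub> finprod (Reg H 3) factor {}"
    by (rule finprod_insert) (use C f in auto)
  also have "\<dots> = twist i (twist j w)"
    unfolding f finprod_empty by (rule r_one[OF C(3)])
  finally have "phi H p 3 w = w \<otimes>\<^bsub>Reg H 3\<^esub> (twist i w' \<otimes>\<^bsub>Reg H 3\<^esub> twist i (twist j w))"
    unfolding f .
  then show "phi H p 3 w = conv H w (conv H (twist i w') (twist i (twist j w)))"
    by (simp only: Reg_simps)
  then show "phi H p 3 w \<in> Reg_N H 3"
    by (simp only: Reg_N_conv R)
qed

lemma phi_1_3:
  "phi H 1 3 w = conv H w (conv H (twist 1 w') (twist 1 (twist 2 w)))" "phi H 1 3 w \<in> Reg_N H 3"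
  by (rule phi_product[OF _ _ shuffles_1_3]; simp)+

lemma phi_2_3:
  "phi H 2 3 w = conv H w (conv H (twist 2 w') (twist 2 (twist 1 w)))" "phi H 2 3 w \<in> Reg_N H 3"
  by (rule phi_product[OF _ _ shuffles_2_3]; simp)+

end

end

section \<open>The components of the Hochschild--Serre image\<close>

context hopf_algebra
begin

lemma legs_2: "(\<Sum>x\<leftarrow>legs H 2 a. F x) = \<Delta> a (\<lambda>b c. \<Sum>x\<leftarrow>legs H (Suc 0) c. F (\<lambda>i. if i \<le> 1 then b else x (i - 1)))"
  and legs_3: "(\<Sum>x\<leftarrow>legs H 3 a. F x) = \<Delta> a (\<lambda>b c. \<Sum>x\<leftarrow>legs H 2 c. F (\<lambda>i. if i \<le> 1 then b else x (i - 1)))"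
  and legs_4: "(\<Sum>x\<leftarrow>legs H 4 a. F x) = \<Delta> a (\<lambda>b c. \<Sum>x\<leftarrow>legs H 3 c. F (\<lambda>i. if i \<le> 1 then b else x (i - 1)))"
  and legs_5: "(\<Sum>x\<leftarrow>legs H 5 a. F x) = \<Delta> a (\<lambda>b c. \<Sum>x\<leftarrow>legs H 4 c. F (\<lambda>i. if i \<le> 1 then b else x (i - 1)))"
  and legs_6: "(\<Sum>x\<leftarrow>legs H 6 a. F x) = \<Delta> a (\<lambda>b c. \<Sum>x\<leftarrow>legs H 5 c. F (\<lambda>i. if i \<le> 1 then b else x (i - 1)))"
  for F :: "_ \<Rightarrow> 'k"
  using legs_Suc[where H = H and k = 0 and a = a and F = F] legs_Suc[where H = H and k = 1 and a = a and F = F] legs_Suc[where H = H and k = 2 and a = a and F = F] legs_Suc[where H = H and k = 3 and a = a and F = F] legs_Suc[where H = H and k = 4 and a = a and F = F]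
  by (simp_all add: eval_nat_numeral)

lemmas legs_simps = legs_2 legs_3 legs_4 legs_5 legs_6 legs_1

lemma conv_3:
  "conv H f g [x, y, z] =
    \<Delta> x (\<lambda>x1 x2. \<Delta> y (\<lambda>y1 y2. \<Delta> z (\<lambda>z1 z2. f [x1, y1, z1] * g [x2, y2, z2])))"
  by (simp add: conv_Cons conv_Nil)

lemma lin_form_3_factors:
  assumes "f \<in> forms H 3" "elin H g"
  shows "lin H (\<lambda>x. f [g x, b, c])" "lin H (\<lambda>x. f [a, g x, c])" "lin H (\<lambda>x. f [a, b, g x])"
  using assms lin_form_1[where f = f and n = 2] lin_form_2[where f = f and n = 1] lin_form_3[where f = f and n = 0]
  by (simp_all add: eval_nat_numeral)

lemma twist_3:
  "twist 1 f [x, y, z] = \<Delta> y (\<lambda>p q. f [p, ad q x, z])"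
  "twist 2 f [x, y, z] = \<Delta> z (\<lambda>p q. f [x, p, ad q y])"
  by (simp_all add: twist_def)

text \<open>Collects the sums argument by argument. Only sums over different elements are
  interchanged, so \<open>f\<close>, \<open>g\<close> and \<open>h\<close> may be arbitrary
  functions.\<close>

lemma conv_conv_3:
  "conv H f (conv H g h) [x, y, z] =
    \<Delta> x (\<lambda>x1 x'. \<Delta> x' (\<lambda>x2 x3. \<Delta> y (\<lambda>y1 y'. \<Delta> y' (\<lambda>y2 y3. \<Delta> z (\<lambda>z1 z'. \<Delta> z' (\<lambda>z2 z3.
      f [x1, y1, z1] * (g [x2, y2, z2] * h [x3, y3, z3])))))))"
proof -
  let ?T = "\<lambda>x1 x2 x3 y1 y2 y3 z1 z2 z3. f [x1, y1, z1] * (g [x2, y2, z2] * h [x3, y3, z3])"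
  have x: "\<Delta> y (\<lambda>y1 y'. \<Delta> z (\<lambda>z1 z'. \<Delta> x' (\<lambda>x2 x3. \<Delta> y' (\<lambda>y2 y3. \<Delta> z' (\<lambda>z2 z3.
        ?T x1 x2 x3 y1 y2 y3 z1 z2 z3))))) =
      \<Delta> x' (\<lambda>x2 x3. \<Delta> y (\<lambda>y1 y'. \<Delta> z (\<lambda>z1 z'. \<Delta> y' (\<lambda>y2 y3. \<Delta> z' (\<lambda>z2 z3.
        ?T x1 x2 x3 y1 y2 y3 z1 z2 z3)))))" for x1 x'
    by (simp only: sw_swap[of H _ x'])
  have y: "\<Delta> z (\<lambda>z1 z'. \<Delta> y' (\<lambda>y2 y3. \<Delta> z' (\<lambda>z2 z3. ?T x1 x2 x3 y1 y2 y3 z1 z2 z3))) =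
      \<Delta> y' (\<lambda>y2 y3. \<Delta> z (\<lambda>z1 z'. \<Delta> z' (\<lambda>z2 z3. ?T x1 x2 x3 y1 y2 y3 z1 z2 z3)))"
    for x1 x2 x3 y1 y'
    by (rule sw_swap)
  show ?thesis
    unfolding conv_3 sw_mult_left[symmetric] x y ..
qed

text \<open>The argument \<open>z\<close> leads because \<open>Lambda\<close> puts the inner
  argument in front. \<open>g\<close> and \<open>h\<close> receive one leg of \<open>x\<close> each,
  and the braidings split both, giving x1((x2 x3)(x4 x5)); one use of coassociativity nests this to
  the right.\<close>

lemma theta_product:
  assumes "f \<in> forms H 3" "g \<in> forms H 3" "h \<in> forms H 3"
  shows "conv H f (conv H (twist 1 g) (twist 1 (twist 2 h))) [z, x, y] =
    (\<Sum>x\<leftarrow>legs H 5 x. \<Sum>y\<leftarrow>legs H 4 y. \<Sum>z\<leftarrow>legs H 3 z.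
      f [z 1, x 1, y 1] * g [x 2, ad (x 3) (z 2), y 2] * h [x 4, y 3, ad (x 5 * y 4) (z 3)])"
proof -
  note li = lin_intros' assms[THEN lin_form_3_factors(1)] assms[THEN lin_form_3_factors(2)]
    assms[THEN lin_form_3_factors(3)]
  \<comment> \<open>The two braidings act on \<open>z3\<close> one after the other;
    \<open>adj_mult\<close> merges them at the end.\<close>
  let ?T = "\<lambda>z1 z2 z3 x1 x2 x3 x4 x5 y1 y2 y3 y4.
    f [z1, x1, y1] * (g [x2, ad x3 z2, y2] * h [x4, y3, ad y4 (ad x5 z3)])"
  have x: "\<Delta> x' (\<lambda>xa xb. \<Delta> y (\<lambda>y1 y'. \<Delta> y' (\<lambda>y2 ya.
        \<Delta> xa (\<lambda>x2 x3. \<Delta> xb (\<lambda>x4 x5. \<Delta> ya (\<lambda>y3 y4. ?T z1 z2 z3 x1 x2 x3 x4 x5 y1 y2 y3 y4)))))) =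
      \<Delta> x' (\<lambda>x2 r. \<Delta> r (\<lambda>x3 s. \<Delta> s (\<lambda>x4 x5. \<Delta> y (\<lambda>y1 y'. \<Delta> y' (\<lambda>y2 ya.
        \<Delta> ya (\<lambda>y3 y4. ?T z1 z2 z3 x1 x2 x3 x4 x5 y1 y2 y3 y4))))))"
    (is "?L = ?R") for z1 z2 z3 x1 x'
  proof -
    have "\<Delta> y (\<lambda>y1 y'. \<Delta> y' (\<lambda>y2 ya.
        \<Delta> xa (\<lambda>x2 x3. \<Delta> xb (\<lambda>x4 x5. \<Delta> ya (\<lambda>y3 y4. ?T z1 z2 z3 x1 x2 x3 x4 x5 y1 y2 y3 y4))))) =
      \<Delta> xa (\<lambda>x2 x3. \<Delta> y (\<lambda>y1 y'. \<Delta> y' (\<lambda>y2 ya.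
        \<Delta> xb (\<lambda>x4 x5. \<Delta> ya (\<lambda>y3 y4. ?T z1 z2 z3 x1 x2 x3 x4 x5 y1 y2 y3 y4)))))" for xa xb
      by (simp only: sw_swap[of H _ xa])
    moreover have "\<Delta> y (\<lambda>y1 y'. \<Delta> y' (\<lambda>y2 ya.
        \<Delta> xb (\<lambda>x4 x5. \<Delta> ya (\<lambda>y3 y4. ?T z1 z2 z3 x1 x2 x3 x4 x5 y1 y2 y3 y4)))) =
      \<Delta> xb (\<lambda>x4 x5. \<Delta> y (\<lambda>y1 y'. \<Delta> y' (\<lambda>y2 ya.
        \<Delta> ya (\<lambda>y3 y4. ?T z1 z2 z3 x1 x2 x3 x4 x5 y1 y2 y3 y4))))" for x2 x3 xb
      by (simp only: sw_swap[of H _ xb])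
    ultimately have "?L = \<Delta> x' (\<lambda>xa xb. \<Delta> xa (\<lambda>x2 x3. \<Delta> xb (\<lambda>x4 x5. \<Delta> y (\<lambda>y1 y'. \<Delta> y' (\<lambda>y2 ya.
        \<Delta> ya (\<lambda>y3 y4. ?T z1 z2 z3 x1 x2 x3 x4 x5 y1 y2 y3 y4))))))"
      by (simp only:)
    also have "\<dots> = ?R"
      by (rule sw_coassoc) (intro li)+
    finally show ?thesis .
  qed
  have z: "\<Delta> x (\<lambda>x1 x'. \<Delta> x' (\<lambda>x2 r. \<Delta> r (\<lambda>x3 s. \<Delta> s (\<lambda>x4 x5. \<Delta> y (\<lambda>y1 y'. \<Delta> y' (\<lambda>y2 ya.
        \<Delta> ya (\<lambda>y3 y4. \<Delta> z' (\<lambda>z2 z3. ?T z1 z2 z3 x1 x2 x3 x4 x5 y1 y2 y3 y4)))))))) =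
      \<Delta> z' (\<lambda>z2 z3. \<Delta> x (\<lambda>x1 x'. \<Delta> x' (\<lambda>x2 r. \<Delta> r (\<lambda>x3 s. \<Delta> s (\<lambda>x4 x5. \<Delta> y (\<lambda>y1 y'. \<Delta> y' (\<lambda>y2 ya.
        \<Delta> ya (\<lambda>y3 y4. ?T z1 z2 z3 x1 x2 x3 x4 x5 y1 y2 y3 y4))))))))" for z1 z'
    by (simp only: sw_swap[of H _ z'])
  have "conv H f (conv H (twist 1 g) (twist 1 (twist 2 h))) [z, x, y] =
    \<Delta> z (\<lambda>z1 z'. \<Delta> z' (\<lambda>z2 z3. \<Delta> x (\<lambda>x1 x'. \<Delta> x' (\<lambda>xa xb. \<Delta> y (\<lambda>y1 y'. \<Delta> y' (\<lambda>y2 ya.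
      \<Delta> xa (\<lambda>x2 x3. \<Delta> xb (\<lambda>x4 x5. \<Delta> ya (\<lambda>y3 y4. ?T z1 z2 z3 x1 x2 x3 x4 x5 y1 y2 y3 y4)))))))))"
    unfolding conv_conv_3 twist_3 sw_mult_right[symmetric] unfolding sw_mult_left[symmetric] ..
  also have "\<dots> = \<Delta> z (\<lambda>z1 z'. \<Delta> x (\<lambda>x1 x'. \<Delta> x' (\<lambda>x2 r. \<Delta> r (\<lambda>x3 s. \<Delta> s (\<lambda>x4 x5.
      \<Delta> y (\<lambda>y1 y'. \<Delta> y' (\<lambda>y2 ya. \<Delta> ya (\<lambda>y3 y4. \<Delta> z' (\<lambda>z2 z3.
      ?T z1 z2 z3 x1 x2 x3 x4 x5 y1 y2 y3 y4)))))))))"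
    unfolding x z ..
  also have "\<dots> = \<Delta> x (\<lambda>x1 x'. \<Delta> x' (\<lambda>x2 r. \<Delta> r (\<lambda>x3 s. \<Delta> s (\<lambda>x4 x5.
      \<Delta> y (\<lambda>y1 y'. \<Delta> y' (\<lambda>y2 ya. \<Delta> ya (\<lambda>y3 y4. \<Delta> z (\<lambda>z1 z'. \<Delta> z' (\<lambda>z2 z3.
      ?T z1 z2 z3 x1 x2 x3 x4 x5 y1 y2 y3 y4)))))))))"
    by (simp only: sw_swap[of H _ z])
  finally show ?thesis
    by (simp add: legs_simps mult.assoc adj_mult)
qed

text \<open>The six legs of \<open>z\<close> are one for \<open>f\<close>, two for \<open>g\<close>
  and three for \<open>h\<close>, since \<open>twist 1\<close> splits again the leg that
  \<open>twist 2\<close> has moved forward. They arise as z1((z2 z3)((z4 z5)z6)), so coassociativity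
  is used twice.\<close>

lemma gamma_product:
  assumes "f \<in> forms H 3" "g \<in> forms H 3" "h \<in> forms H 3"
  shows "conv H f (conv H (twist 2 g) (twist 2 (twist 1 h))) [x, y, z] =
    (\<Sum>z\<leftarrow>legs H 6 z. \<Sum>x\<leftarrow>legs H 3 x. \<Sum>y\<leftarrow>legs H 3 y.
      f [x 1, y 1, z 1] * g [x 2, z 2, ad (z 3) (y 2)] * h [z 4, ad (z 5) (x 3), ad (z 6) (y 3)])"
proof -
  note li = lin_intros' assms[THEN lin_form_3_factors(1)] assms[THEN lin_form_3_factors(2)]
    assms[THEN lin_form_3_factors(3)]
  let ?T = "\<lambda>z1 z2 z3 z4 z5 z6 x1 x2 x3 y1 y2 y3.
    f [x1, y1, z1] * (g [x2, z2, ad z3 y2] * h [z4, ad z5 x3, ad z6 y3])"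
  let ?xy = "\<lambda>z1 z2 z3 z4 z5 z6. \<Delta> x (\<lambda>x1 x'. \<Delta> x' (\<lambda>x2 x3. \<Delta> y (\<lambda>y1 y'. \<Delta> y' (\<lambda>y2 y3.
    ?T z1 z2 z3 z4 z5 z6 x1 x2 x3 y1 y2 y3))))"
  have xy: "\<Delta> x (\<lambda>x1 x'. \<Delta> x' (\<lambda>x2 x3. \<Delta> y (\<lambda>y1 y'. \<Delta> y' (\<lambda>y2 y3. \<Delta> c (\<lambda>d e.
        K d e x1 x2 x3 y1 y2 y3))))) =
      \<Delta> c (\<lambda>d e. \<Delta> x (\<lambda>x1 x'. \<Delta> x' (\<lambda>x2 x3. \<Delta> y (\<lambda>y1 y'. \<Delta> y' (\<lambda>y2 y3.
        K d e x1 x2 x3 y1 y2 y3)))))" for c and K :: "_ \<Rightarrow> _ \<Rightarrow> _ \<Rightarrow> _ \<Rightarrow> _ \<Rightarrow> _ \<Rightarrow> _ \<Rightarrow> _ \<Rightarrow> 'k"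
    by (simp only: sw_swap[of H _ c])
  have assoc: "\<Delta> r (\<lambda>za zb. \<Delta> za (\<lambda>z2 z3. \<Delta> zb (\<lambda>p z6. \<Delta> p (\<lambda>z4 z5. ?xy z1 z2 z3 z4 z5 z6)))) =
      \<Delta> r (\<lambda>z2 s. \<Delta> s (\<lambda>z3 t. \<Delta> t (\<lambda>z4 u. \<Delta> u (\<lambda>z5 z6. ?xy z1 z2 z3 z4 z5 z6))))" for r z1
  proof -
    have "\<Delta> zb (\<lambda>p z6. \<Delta> p (\<lambda>z4 z5. ?xy z1 z2 z3 z4 z5 z6)) =
        \<Delta> zb (\<lambda>z4 u. \<Delta> u (\<lambda>z5 z6. ?xy z1 z2 z3 z4 z5 z6))" for zb z2 z3
      by (rule sw_coassoc) (intro li)+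
    then have "\<Delta> r (\<lambda>za zb. \<Delta> za (\<lambda>z2 z3. \<Delta> zb (\<lambda>p z6. \<Delta> p (\<lambda>z4 z5. ?xy z1 z2 z3 z4 z5 z6)))) =
        \<Delta> r (\<lambda>za zb. \<Delta> za (\<lambda>z2 z3. \<Delta> zb (\<lambda>z4 u. \<Delta> u (\<lambda>z5 z6. ?xy z1 z2 z3 z4 z5 z6))))"
      by (simp only:)
    also have "\<dots> = \<Delta> r (\<lambda>z2 s. \<Delta> s (\<lambda>z3 t. \<Delta> t (\<lambda>z4 u. \<Delta> u (\<lambda>z5 z6. ?xy z1 z2 z3 z4 z5 z6))))"
      by (rule sw_coassoc) (intro li)+
    finally show ?thesis .
  qed
  have "conv H f (conv H (twist 2 g) (twist 2 (twist 1 h))) [x, y, z] =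
    \<Delta> x (\<lambda>x1 x'. \<Delta> x' (\<lambda>x2 x3. \<Delta> y (\<lambda>y1 y'. \<Delta> y' (\<lambda>y2 y3. \<Delta> z (\<lambda>z1 r. \<Delta> r (\<lambda>za zb.
      \<Delta> za (\<lambda>z2 z3. \<Delta> zb (\<lambda>p z6. \<Delta> p (\<lambda>z4 z5. ?T z1 z2 z3 z4 z5 z6 x1 x2 x3 y1 y2 y3)))))))))"
    unfolding conv_conv_3 twist_3 sw_mult_right[symmetric] unfolding sw_mult_left[symmetric] ..
  also have "\<dots> = \<Delta> z (\<lambda>z1 r. \<Delta> r (\<lambda>za zb. \<Delta> za (\<lambda>z2 z3. \<Delta> zb (\<lambda>p z6. \<Delta> p (\<lambda>z4 z5.
      ?xy z1 z2 z3 z4 z5 z6)))))"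
    unfolding xy ..
  also have "\<dots> = \<Delta> z (\<lambda>z1 r. \<Delta> r (\<lambda>z2 s. \<Delta> s (\<lambda>z3 t. \<Delta> t (\<lambda>z4 u. \<Delta> u (\<lambda>z5 z6.
      ?xy z1 z2 z3 z4 z5 z6)))))"
    unfolding assoc ..
  finally show ?thesis
    by (simp add: legs_simps mult.assoc)
qed

end

context fd_cocomm_hopf_algebra
begin

text \<open>Component \<open>l\<close> comes from the shuffles with \<open>p = 3 - l\<close>,
  because \<open>Lambda\<close> exchanges the blocks: \<gamma> belongs to \<open>p = 2\<close> and
  \<theta> to \<open>p = 1\<close>.\<close>

lemma hs_components:
  assumes "w \<in> Reg_N H 3"
  shows "hs_component H 3 w 0 [] = w" "(\<lambda>a. hs_component H 3 w 3 a []) = w"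
    "hs_component H 3 w 1 = bp_gamma H w" "hs_component H 3 w 2 = bp_theta H w"
    "hs_component H 3 w 1 \<in> C_N H 1 2" "hs_component H 3 w 2 \<in> C_N H 2 1"
proof -
  let ?w' = "inv\<^bsub>Reg H 3\<^esub> w"
  have forms: "w \<in> forms H 3" "?w' \<in> forms H 3"
    using assms Reg_N_inv[OF assms] by (auto simp: Reg_N_def intro: Reg_forms)
  have off: "w v = 0" if "length v \<noteq> 3" for v
    using forms(1) that by (rule forms_off_length)
  show "hs_component H 3 w 0 [] = w" "(\<lambda>a. hs_component H 3 w 3 a []) = w"
    using off by (auto simp: hs_component_def Lambda_def phi_trivial[OF assms])
  have c: "hs_component H 3 w 1 = Lambda 2 1 (phi H 2 3 w)" "hs_component H 3 w 2 = Lambda 1 2 (phi H 1 3 w)"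
    by (simp_all add: hs_component_def)
  have l1: "\<exists>x. v = [x]" if "length v = 1" for v :: "'b list"
    using that by (cases v) auto
  have l2: "\<exists>x y. v = [x, y]" if "length v = 2" for v :: "'b list"
    using that by (cases v; cases "tl v") auto
  show "hs_component H 3 w 1 = bp_gamma H w"
  proof (intro ext)
    fix a b :: "'b list"
    show "hs_component H 3 w 1 a b = bp_gamma H w a b"
    proof (cases "length a = 1 \<and> length b = 2")
      case True
      with l1 l2 obtain x y z where "a = [z]" "b = [x, y]" by blast
      then show ?thesis
        unfolding c using gamma_product[OF forms(1,2,1), of x y z]
        by (simp add: Lambda_def bp_gamma_def phi_2_3(1)[OF assms])
    qed (unfold c, auto simp: Lambda_def bp_gamma_def)
  qed
  show "hs_component H 3 w 2 = bp_theta H w"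
  proof (intro ext)
    fix a b :: "'b list"
    show "hs_component H 3 w 2 a b = bp_theta H w a b"
    proof (cases "length a = 2 \<and> length b = 1")
      case True
      with l1 l2 obtain x y z where "b = [z]" "a = [x, y]" by blast
      then show ?thesis
        unfolding c using theta_product[OF forms(1,2,1), of z x y]
        by (simp add: Lambda_def bp_theta_def phi_1_3(1)[OF assms, unfolded One_nat_def])
    qed (unfold c, auto simp: Lambda_def bp_theta_def)
  qed
  show "hs_component H 3 w 1 \<in> C_N H 1 2" "hs_component H 3 w 2 \<in> C_N H 2 1"
    unfolding c using phi_1_3(2)[OF assms] phi_2_3(2)[OF assms]
    by (auto intro!: Lambda_C_N simp: eval_nat_numeral)
qed

end

theorem theorem4p3:
  fixes H :: "('k::field, 'a::ring_1) hopf" and w :: "'a list \<Rightarrow> 'k"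
  assumes "fd_cocomm_hopf_algebra H"
    and "normalized_3_cocycle H w"
  shows "hs_image3 H w \<in> deformation_data H \<and>
         deformed_double H (hs_image3 H w) = dpr_bp_double H w"
proof -
  interpret fd_cocomm_hopf_algebra H by (rule assms(1))
  have w: "w \<in> Reg_N H 3"
    using assms(2) by (simp add: normalized_3_cocycle_def)
  note hs = hs_components[OF w]
  have "hs_image3 H w = (w, bp_gamma H w, bp_theta H w, w)"
    by (simp only: hs_image3_def hs(1-4))
  moreover have "bp_gamma H w \<in> C_N H 1 2" "bp_theta H w \<in> C_N H 2 1"
    using hs(3-6) by simp_all
  ultimately show ?thesis
    using w by (simp add: deformation_data_def deformed_double_def dpr_bp_double_def)
qed

end
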